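(* Let $X,Y$ be compact metric spaces and let $T:F_+(Y)\to F_+(X)$ be a compactly standard functional capacity, i.e. for every $x\in X$ there is $\sigma\in\mathcal{P}(Y)$ such that $\sup_{K\ \mathrm{compact}}\{\sigma(K)-T\chi_K(x)\}<+\infty$. Then: (1) The map $\overline{T}$ defined for every $g\in C(Y)$ by $$\overline{T}g(x):=\sup_{\sigma\in\mathcal{P}(Y)}\ \inf_{O\ \mathrm{open}}\Big\{\int_Y(g-\chi_O)\,d\sigma+T\chi_{\bar O}(x)\Big\}$$ is a $K$-saturated backward Kantorovich operator such that $\overline{T}\le_{\mathcal{K}}T$. (2) If $T$ is a Kantorovich operator then $T\le\overline{T}$, and for any $g\in C(Y)$, $$\overline{T}g(x)=\sup\{Sg(x):\ S\ \text{Kantorovich operator with}\ \hat S\le\hat T\}.$$ (3) If $T$ is $K$-saturated, then $\overline{T}\le T$. (4) If $T$ is a $K$-saturated Kantorovich operator, then $T=\overline{T}$. (5) $\overline{T}$ is minimal among $K$-saturated Kantorovich operators greater than $T$, in the sense that every $K$-saturated Kantorovich operator $R$ with $R\ge T$ satisfies $R\ge\overline{T}$.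
   Context: $\mathcal{P}$: probability measures, weak$^*$ topology. $\chi_A$: indicator of $A$. $F_+(Y)$: functions $Y\to[0,+\infty]$. $USC(X)$: bounded above, proper (not identically $-\infty$), upper semi-continuous functions $X\to[-\infty,\infty)$; $USC_+$: its non-negative elements. Functional capacity: a map $T:F_+(Y)\to F_+(X)$ such that (i) $f\le g\Rightarrow Tf\le Tg$; (ii) $T$ maps $USC_+(Y)$ to $USC(X)$, and $g_n\downarrow g$ in $USC_+(Y)$ implies $Tg_n\downarrow Tg$; (iii) $g_n\uparrow g$ in $F_+(Y)$ implies $Tg_n\uparrow Tg$. Backward Kantorovich operator ("Kantorovich operator"): a map $S:C(Y)\to USC(X)$ that is monotone, satisfies $S(g+c)=Sg+c$ for $c\in\mathbb{R}$, is convex ($S(\lambda g_1+(1-\lambda)g_2)\le\lambda Sg_1+(1-\lambda)Sg_2$, $\lambda\in[0,1]$), and lower semi-continuous ($g_n\to g$ uniformly implies $\liminf_nSg_n\ge Sg$ pointwise). It is extended to upper semi-continuous $g$ by $Sg(x)=\inf\{Sh(x):h\in C(Y),h\ge g\}$. A functional capacity $T$ is called a Kantorovich operator if it coincides on non-negative upper semi-continuous functions with (the extension of) a backward Kantorovich operator; values on functions in $C(Y)$ then refer to that operator. For such maps $S$ write $S^x(A)=S\chi_A(x)$. $S\le_{\mathcal{K}}T$ means $S^x(K)\le T^x(K)$ for every $x\in X$ and compact $K\subset Y$. The Choquet extension is $\hat Tf(x)=\int_0^{+\infty}T^x(\{f\ge\alpha\})\,d\alpha$ for non-negative $f$ on $Y$;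 one has $\hat S\le\hat T$ on $USC_+(Y)$ if and only if $S\le_{\mathcal{K}}T$, and $\hat S\le\hat T$ is understood this way. $T$ is $K$-saturated if for any Kantorovich operator $S:USC(Y)\to USC(X)$: $S\le_{\mathcal{K}}T$ if and only if $S\le T$ on $USC_+(Y)$. Inequalities and equalities between $T$ and $\overline{T}$ (or $R$) are understood on $USC_+(Y)$. *)

theory Defs
  imports "HOL-Probability.Probability"
begin

text \<open>
  The spaces \<open>X\<close> and \<open>Y\<close> are the types \<open>'x\<close> and \<open>'y\<close>, which the theorem assumes to be compact
  metric spaces. All extended-valued functions take values in \<^typ>\<open>ereal\<close>; \<open>F\<^sub>+\<close> is the set of
  nonnegative ones, so that a map on \<open>F\<^sub>+(Y)\<close> is only constrained on that set.
\<close>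

definition F_plus :: "('a \<Rightarrow> ereal) set" where
  "F_plus = {f. \<forall>x. 0 \<le> f x}"

definition usc :: "('a::topological_space \<Rightarrow> ereal) \<Rightarrow> bool" where
  "usc f \<longleftrightarrow> (\<forall>a. open {x. f x < a})"

definition USC :: "('a::topological_space \<Rightarrow> ereal) set" where
  "USC = {f. usc f \<and> (\<exists>M::real. \<forall>x. f x \<le> ereal M) \<and> (\<exists>x. f x \<noteq> -\<infinity>)}"

definition USC_plus :: "('a::topological_space \<Rightarrow> ereal) set" where
  "USC_plus = {f \<in> USC. \<forall>x. 0 \<le> f x}"

definition decreases_to :: "(nat \<Rightarrow> 'a \<Rightarrow> ereal) \<Rightarrow> ('a \<Rightarrow> ereal) \<Rightarrow> bool" where
  "decreases_to g h \<longleftrightarrow> decseq g \<and> (\<forall>y. (\<lambda>n. g n y) \<longlonglongrightarrow> h y)"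

definition increases_to :: "(nat \<Rightarrow> 'a \<Rightarrow> ereal) \<Rightarrow> ('a \<Rightarrow> ereal) \<Rightarrow> bool" where
  "increases_to g h \<longleftrightarrow> incseq g \<and> (\<forall>y. (\<lambda>n. g n y) \<longlonglongrightarrow> h y)"

definition functional_capacity ::
  "(('y::topological_space \<Rightarrow> ereal) \<Rightarrow> ('x::topological_space \<Rightarrow> ereal)) \<Rightarrow> bool" where
  "functional_capacity T \<longleftrightarrow>
     (\<forall>f\<in>F_plus. T f \<in> F_plus) \<and>
     (\<forall>f\<in>F_plus. \<forall>g\<in>F_plus. f \<le> g \<longrightarrow> T f \<le> T g) \<and>
     (\<forall>f\<in>USC_plus. T f \<in> USC) \<and>
     (\<forall>g h. (\<forall>n. g n \<in> USC_plus) \<and> h \<in> USC_plus \<and> decreases_to g h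
        \<longrightarrow> decreases_to (\<lambda>n. T (g n)) (T h)) \<and>
     (\<forall>g h. (\<forall>n. g n \<in> F_plus) \<and> h \<in> F_plus \<and> increases_to g h
        \<longrightarrow> increases_to (\<lambda>n. T (g n)) (T h))"

definition prob_measures :: "'y::topological_space measure set" where
  "prob_measures = {\<sigma>. prob_space \<sigma> \<and> sets \<sigma> = sets borel}"

definition compactly_standard ::
  "(('y::topological_space \<Rightarrow> ereal) \<Rightarrow> ('x \<Rightarrow> ereal)) \<Rightarrow> bool" where
  "compactly_standard T \<longleftrightarrow>
     (\<forall>x. \<exists>\<sigma>\<in>prob_measures. (SUP K\<in>{K. compact K}. ereal (measure \<sigma> K) - T (indicator K) x) < \<infinity>)"

text \<open>Such an operator is only constrained on \<open>C(Y)\<close>, i.e. on continuous real functions.\<close>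

definition backward_kantorovich ::
  "(('y::topological_space \<Rightarrow> real) \<Rightarrow> ('x::topological_space \<Rightarrow> ereal)) \<Rightarrow> bool" where
  "backward_kantorovich S \<longleftrightarrow>
     (\<forall>g. continuous_on UNIV g \<longrightarrow> S g \<in> USC) \<and>
     (\<forall>g h. continuous_on UNIV g \<and> continuous_on UNIV h \<and> g \<le> h \<longrightarrow> S g \<le> S h) \<and>
     (\<forall>g c x. continuous_on UNIV g \<longrightarrow> S (\<lambda>y. g y + c) x = S g x + ereal c) \<and>
     (\<forall>g h l x. continuous_on UNIV g \<and> continuous_on UNIV h \<and> 0 \<le> l \<and> l \<le> 1 \<longrightarrow>
        S (\<lambda>y. l * g y + (1 - l) * h y) x \<le> ereal l * S g x + ereal (1 - l) * S h x) \<and>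
     (\<forall>g h x. (\<forall>n::nat. continuous_on UNIV (g n)) \<and> continuous_on UNIV h \<and>
        uniform_limit UNIV g h sequentially \<longrightarrow> S h x \<le> liminf (\<lambda>n. S (g n) x))"

definition usc_ext ::
  "(('y::topological_space \<Rightarrow> real) \<Rightarrow> ('x \<Rightarrow> ereal)) \<Rightarrow> ('y \<Rightarrow> ereal) \<Rightarrow> ('x \<Rightarrow> ereal)" where
  "usc_ext S g = (\<lambda>x. INF h\<in>{h. continuous_on UNIV h \<and> (\<forall>y. g y \<le> ereal (h y))}. S h x)"

text \<open>A functional capacity that is a Kantorovich operator.\<close>

definition kantorovich_capacity ::
  "(('y::topological_space \<Rightarrow> ereal) \<Rightarrow> ('x::topological_space \<Rightarrow> ereal)) \<Rightarrow> bool" where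
  "kantorovich_capacity T \<longleftrightarrow> functional_capacity T \<and>
     (\<exists>S. backward_kantorovich S \<and> (\<forall>f\<in>USC_plus. T f = usc_ext S f))"

definition le_compact ::
  "(('y::topological_space \<Rightarrow> ereal) \<Rightarrow> ('x \<Rightarrow> ereal)) \<Rightarrow> (('y \<Rightarrow> ereal) \<Rightarrow> ('x \<Rightarrow> ereal)) \<Rightarrow> bool"
  (infix "\<le>\<^sub>K" 50) where
  "S \<le>\<^sub>K T \<longleftrightarrow> (\<forall>x K. compact K \<longrightarrow> S (indicator K) x \<le> T (indicator K) x)"

definition le_usc ::
  "(('y::topological_space \<Rightarrow> ereal) \<Rightarrow> ('x \<Rightarrow> ereal)) \<Rightarrow> (('y \<Rightarrow> ereal) \<Rightarrow> ('x \<Rightarrow> ereal)) \<Rightarrow> bool"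
  (infix "\<le>\<^sub>U" 50) where
  "S \<le>\<^sub>U T \<longleftrightarrow> (\<forall>f\<in>USC_plus. \<forall>x. S f x \<le> T f x)"

text \<open>
  The quantifier ranges over all backward Kantorovich operators, through their extensions to upper
  semi-continuous functions.
\<close>

definition K_saturated ::
  "(('y::topological_space \<Rightarrow> ereal) \<Rightarrow> ('x::topological_space \<Rightarrow> ereal)) \<Rightarrow> bool" where
  "K_saturated T \<longleftrightarrow>
     (\<forall>S. backward_kantorovich S \<longrightarrow> (usc_ext S \<le>\<^sub>K T \<longleftrightarrow> usc_ext S \<le>\<^sub>U T))"

text \<open>
  The Choquet extension, for set functions that are nonnegative on the superlevel sets of \<open>f\<close>.
\<close>

definition choquet ::
  "(('y \<Rightarrow> ereal) \<Rightarrow> ('x \<Rightarrow> ereal)) \<Rightarrow> ('y \<Rightarrow> ereal) \<Rightarrow> ('x \<Rightarrow> ennreal)" where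
  "choquet T f = (\<lambda>x. \<integral>\<^sup>+\<alpha>\<in>{0..}. e2ennreal (T (indicator {y. ereal \<alpha> \<le> f y}) x) \<partial>lborel)"

text \<open>
  The comparison of Choquet extensions is by convention the comparison of \<open>S\<close> and \<open>T\<close> on compact
  sets. The two agree when \<open>S\<close> and \<open>T\<close> vanish on the empty set (lemma below). Otherwise the
  Choquet integrand is equal to the nonzero constant \<open>S\<^sup>x({})\<close> for all large levels, so that the
  integrals are infinite and comparing them carries no information.
\<close>

definition choquet_le ::
  "(('y::topological_space \<Rightarrow> ereal) \<Rightarrow> ('x \<Rightarrow> ereal)) \<Rightarrow> (('y \<Rightarrow> ereal) \<Rightarrow> ('x \<Rightarrow> ereal)) \<Rightarrow> bool" where
  "choquet_le S T \<longleftrightarrow> S \<le>\<^sub>K T"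

lemma compact_superlevel:
  fixes f :: "'y::topological_space \<Rightarrow> ereal"
  assumes "compact (UNIV :: 'y set)" "usc f"
  shows "compact {y. a \<le> f y}"
proof -
  have "{y. a \<le> f y} = - {y. f y < a}" by auto
  moreover have "open {y. f y < a}" using assms(2) by (auto simp: usc_def)
  ultimately have "closed {y. a \<le> f y}" by (simp add: closed_Compl)
  with assms(1) show ?thesis using compact_Int_closed[of UNIV] by simp
qed

lemma indicator_USC_plus:
  fixes K :: "'y::t2_space set"
  assumes "compact K"
  shows "indicator K \<in> (USC_plus :: ('y \<Rightarrow> ereal) set)"
proof -
  have "open {y. indicator K y < a}" for a :: ereal
  proof -
    consider "a \<le> 0" | "0 < a" "a \<le> 1" | "1 < a" by fastforce
    hence "{y. indicator K y < a} \<in> {{}, - K, UNIV}"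
    proof cases
      case 1
      hence "\<not> indicator K y < a" for y
        using order.trans[of a 0 "indicator K y"] by (auto simp: not_less)
      thus ?thesis by simp
    next
      case 2
      hence "{y. indicator K y < a} = - K" by (auto simp: indicator_def split: if_splits)
      thus ?thesis by simp
    next
      case 3
      have "0 < a" by (rule less_trans[OF _ 3]) simp
      with 3 show ?thesis by (auto simp: indicator_def)
    qed
    thus ?thesis using compact_imp_closed[OF assms] by auto
  qed
  moreover have "indicator K y \<le> ereal 1" for y by (auto simp: indicator_def)
  ultimately show ?thesis by (auto simp: USC_plus_def USC_def usc_def indicator_def)
qed

lemma choquet_indicator:
  fixes T :: "('y \<Rightarrow> ereal) \<Rightarrow> ('x \<Rightarrow> ereal)"
  assumes "T (indicator {}) x = 0"
  shows "choquet T (indicator K) x = e2ennreal (T (indicator K) x)"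
proof -
  have "choquet T (indicator K) x
      = (\<integral>\<^sup>+\<alpha>. e2ennreal (T (indicator K) x) * indicator {0<..1::real} \<alpha> \<partial>lborel)"
    unfolding choquet_def
  proof (rule nn_integral_cong_AE)
    have "e2ennreal (T (indicator {y. ereal \<alpha> \<le> indicator K y}) x) * indicator {0..} \<alpha>
        = e2ennreal (T (indicator K) x) * indicator {0<..1} \<alpha>" if nz: "\<alpha> \<noteq> 0" for \<alpha> :: real
    proof -
      consider "\<alpha> < 0" | "0 < \<alpha>" "\<alpha> \<le> 1" | "1 < \<alpha>" using nz by fastforce
      thus ?thesis
      proof cases
        case 2
        have "{y. ereal \<alpha> \<le> indicator K y} = K" using 2 by (auto simp: indicator_def split: if_splits)
        thus ?thesis using 2 by simp
      next
        case 3
        have "{y. ereal \<alpha> \<le> indicator K y} = {}" using 3 by (auto simp: indicator_def split: if_splits)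
        thus ?thesis using 3 assms by simp
      qed auto
    qed
    thus "AE \<alpha> in lborel. e2ennreal (T (indicator {y. ereal \<alpha> \<le> indicator K y}) x) * indicator {0..} \<alpha>
        = e2ennreal (T (indicator K) x) * indicator {0<..1} \<alpha>"
      using AE_lborel_singleton[of "0::real"] by (auto elim!: eventually_mono)
  qed
  also have "\<dots> = e2ennreal (T (indicator K) x)"
    by (simp add: nn_integral_cmult_indicator)
  finally show ?thesis .
qed

lemma choquet_le_iff:
  fixes S T :: "('y::t2_space \<Rightarrow> ereal) \<Rightarrow> ('x \<Rightarrow> ereal)"
  assumes "compact (UNIV :: 'y set)"
    and "\<And>x. S (indicator {}) x = 0" "\<And>x. T (indicator {}) x = 0"
    and "\<And>x K. compact K \<Longrightarrow> 0 \<le> S (indicator K) x" "\<And>x K. compact K \<Longrightarrow> 0 \<le> T (indicator K) x"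
  shows "choquet_le S T \<longleftrightarrow> (\<forall>f\<in>USC_plus. \<forall>x. choquet S f x \<le> choquet T f x)"
proof
  assume L: "choquet_le S T"
  show "\<forall>f\<in>USC_plus. \<forall>x. choquet S f x \<le> choquet T f x"
  proof (intro ballI allI)
    fix f :: "'y \<Rightarrow> ereal" and x :: 'x
    assume "f \<in> USC_plus"
    hence "compact {y. ereal \<alpha> \<le> f y}" for \<alpha>
      using compact_superlevel[OF assms(1)] by (auto simp: USC_plus_def USC_def)
    thus "choquet S f x \<le> choquet T f x"
      unfolding choquet_def using L
      by (intro nn_integral_mono mult_right_mono e2ennreal_mono)
         (auto simp: choquet_le_def le_compact_def)
  qed
next
  assume R: "\<forall>f\<in>USC_plus. \<forall>x. choquet S f x \<le> choquet T f x"
  show "choquet_le S T"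
    unfolding choquet_le_def le_compact_def
  proof (intro allI impI)
    fix x :: 'x and K :: "'y set"
    assume K: "compact K"
    have "choquet S (indicator K) x \<le> choquet T (indicator K) x"
      using R indicator_USC_plus[OF K] by blast
    hence "e2ennreal (S (indicator K) x) \<le> e2ennreal (T (indicator K) x)"
      by (simp add: choquet_indicator assms)
    hence "enn2ereal (e2ennreal (S (indicator K) x)) \<le> enn2ereal (e2ennreal (T (indicator K) x))"
      by (simp add: less_eq_ennreal.rep_eq)
    thus "S (indicator K) x \<le> T (indicator K) x"
      using assms(4,5)[OF K] by (simp add: enn2ereal_e2ennreal)
  qed
qed

definition Tbar ::
  "(('y::topological_space \<Rightarrow> ereal) \<Rightarrow> ('x \<Rightarrow> ereal)) \<Rightarrow> ('y \<Rightarrow> real) \<Rightarrow> ('x \<Rightarrow> ereal)" where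
  "Tbar T g = (\<lambda>x. SUP \<sigma>\<in>prob_measures. INF U\<in>{U. open U}.
     ereal (\<integral>y. g y - indicator U y \<partial>\<sigma>) + T (indicator (closure U)) x)"

end

theory Submission
  imports Defs
begin

text \<open>
  With \<open>c x \<sigma> = sup {\<sigma>(U) - T \<chi>\<^bsub>cl U\<^esub>(x) | U open}\<close> the operator reads
  \<open>Tbar T g x = sup {\<integral>g d\<sigma> - c x \<sigma> | \<sigma>}\<close>, and \<open>c\<close> is real-valued, so \<open>Tbar T g x\<close> is real. Monotonicity,
  translation invariance, convexity and lower semi-continuity are immediate from this. Upper
  semi-continuity in \<open>x\<close> follows from the weak sequential compactness of the probability measures on
  \<open>Y\<close> and the lower semi-continuity of \<open>\<sigma> \<mapsto> \<sigma>(U)\<close>. Open neighbourhoods decreasing to a compact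
  set give \<open>Tbar T \<le>\<^sub>K T\<close>.

  All other claims follow once every backward Kantorovich operator \<open>S \<le>\<^sub>K T\<close> is known to satisfy
  \<open>S \<le> Tbar T\<close> on continuous functions. By the Hahn-Banach and Riesz theorems \<open>S(\<cdot>)(x)\<close> has at \<open>g\<close> a
  subgradient that is a probability measure \<open>\<sigma>\<close>; testing it against continuous functions above
  \<open>\<chi>\<^bsub>cl U\<^esub>\<close> gives \<open>S g x + \<sigma>(U) - \<integral>g d\<sigma> \<le> T \<chi>\<^bsub>cl U\<^esub>(x)\<close>, that is, \<open>S g x \<le> \<integral>g d\<sigma> - c x \<sigma>\<close>.

  Weak sequential compactness is reduced to Helly's theorem on the real line: \<open>Y\<close> embeds into \<open>\<real>\<close>
  by a Borel map (ternary digits of membership in a sequence of balls) whose inverse is uniformly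
  continuous, so that limits on the closure of the range can be pushed back to \<open>Y\<close>. The Riesz theorem
  then follows by approximating a functional by finitely supported measures through partitions of
  unity.
\<close>

subsection \<open>Subgradients of convex functions\<close>

definition sublinear :: "('a::real_vector \<Rightarrow> real) \<Rightarrow> bool" where
  "sublinear q \<longleftrightarrow> (\<forall>x y. q (x + y) \<le> q x + q y) \<and> (\<forall>c>0. \<forall>x. q (c *\<^sub>R x) = c * q x)"

lemma sublinear_add: "sublinear q \<Longrightarrow> q (x + y) \<le> q x + q y"
  by (simp add: sublinear_def)

lemma sublinear_scale: "sublinear q \<Longrightarrow> 0 < c \<Longrightarrow> q (c *\<^sub>R x) = c * q x"
  by (simp add: sublinear_def)

lemma sublinear_zero: "sublinear q \<Longrightarrow> q 0 = 0"
  using sublinear_scale[of q 2 0] by simp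

lemma sublinear_minus: "sublinear q \<Longrightarrow> - q (- x) \<le> q x"
  using sublinear_add[of q x "- x"] sublinear_zero[of q] by simp

lemma sublinear_scale_nonneg: "sublinear q \<Longrightarrow> 0 \<le> c \<Longrightarrow> q (c *\<^sub>R x) = c * q x"
  using sublinear_scale[of q c x] sublinear_zero[of q] by (cases "c = 0") auto

text \<open>
  For a minimal \<open>q\<close> this forces \<open>q' = q\<close>, so that \<open>q\<close> is superadditive, hence linear.
\<close>

lemma sublinear_shift:
  assumes q: "sublinear q"
  obtains q' where "sublinear q'" "\<And>x. q' x \<le> q x" "\<And>x. q' x \<le> q (x + y) - q y"
proof -
  \<comment> \<open>Choosing \<open>t = 0\<close> and \<open>t = 1\<close> in the infimum yields the
    two required upper bounds. Subadditivity bounds every term from below by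
    \<open>- q (- x)\<close>, so the infimum is finite.\<close>
  define q' where "q' x = (INF t\<in>{0..}. q (x + t *\<^sub>R y) - t * q y)" for x
  have bdd: "bdd_below ((\<lambda>t. q (x + t *\<^sub>R y) - t * q y) ` {0..})" for x
  proof (rule bdd_belowI2)
    fix t :: real assume "t \<in> {0..}"
    have "q (t *\<^sub>R y) \<le> q (x + t *\<^sub>R y) + q (- x)"
      using sublinear_add[OF q, of "x + t *\<^sub>R y" "- x"] by simp
    thus "- q (- x) \<le> q (x + t *\<^sub>R y) - t * q y"
      using sublinear_scale_nonneg[OF q, of t y] \<open>t \<in> {0..}\<close> by simp
  qed
  have upper: "q' x \<le> q (x + t *\<^sub>R y) - t * q y" if "0 \<le> t" for x t
    unfolding q'_def using that by (intro cINF_lower[OF bdd]) auto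
  show ?thesis
  proof (rule that)
    show "q' x \<le> q x" for x using upper[of 0 x] by simp
    show "q' x \<le> q (x + y) - q y" for x using upper[of 1 x] by simp
    show "sublinear q'"
      unfolding sublinear_def
    proof (intro conjI allI impI)
      fix u v
      have "q' (u + v) - (q (v + s *\<^sub>R y) - s * q y) \<le> q (u + t *\<^sub>R y) - t * q y"
        if "0 \<le> t" "0 \<le> s" for t s
      proof -
        have "q' (u + v) \<le> q (u + v + (t + s) *\<^sub>R y) - (t + s) * q y"
          by (rule upper) (use that in simp)
        also have "u + v + (t + s) *\<^sub>R y = (u + t *\<^sub>R y) + (v + s *\<^sub>R y)"
          by (simp add: scaleR_add_left)
        finally show ?thesis
          using sublinear_add[OF q, of "u + t *\<^sub>R y" "v + s *\<^sub>R y"] by (simp add: algebra_simps)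
      qed
      hence "q' (u + v) - (q (v + s *\<^sub>R y) - s * q y) \<le> q' u" if "0 \<le> s" for s
        unfolding q'_def[of u] using that by (intro cINF_greatest) auto
      hence "q' (u + v) - q' u \<le> q (v + s *\<^sub>R y) - s * q y" if "0 \<le> s" for s
        using that by (fastforce simp: algebra_simps)
      hence "q' (u + v) - q' u \<le> q' v"
        unfolding q'_def[of v] by (intro cINF_greatest) auto
      thus "q' (u + v) \<le> q' u + q' v" by simp
    next
      fix c :: real and u assume c: "0 < c"
      \<comment> \<open>One inequality for all positive scalars suffices: the reverse one is the
        same inequality for \<open>inverse c\<close> at the scaled vector.\<close>
      have le: "q' (c *\<^sub>R u) \<le> c * q' u" if c: "0 < c" for c u
      proof -
        have "q' (c *\<^sub>R u) / c \<le> q (u + t *\<^sub>R y) - t * q y" if "0 \<le> t" for t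
        proof -
          have "q' (c *\<^sub>R u) \<le> q (c *\<^sub>R u + (c * t) *\<^sub>R y) - (c * t) * q y"
            by (rule upper) (use that c in simp)
          also have "c *\<^sub>R u + (c * t) *\<^sub>R y = c *\<^sub>R (u + t *\<^sub>R y)"
            by (simp add: scaleR_add_right)
          also have "q (c *\<^sub>R (u + t *\<^sub>R y)) = c * q (u + t *\<^sub>R y)" by (rule sublinear_scale[OF q c])
          finally show ?thesis using c by (simp add: field_simps)
        qed
        hence "q' (c *\<^sub>R u) / c \<le> q' u"
          unfolding q'_def[of u] by (intro cINF_greatest) auto
        thus ?thesis using c by (simp add: field_simps)
      qed
      have "q' (inverse c *\<^sub>R (c *\<^sub>R u)) \<le> inverse c * q' (c *\<^sub>R u)"
        using c by (intro le) simp
      hence "c * q' u \<le> q' (c *\<^sub>R u)" using c by (simp add: field_simps)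
      with le[OF c, of u] show "q' (c *\<^sub>R u) = c * q' u" by simp
    qed
  qed
qed

text \<open>Zorn's lemma for the reversed pointwise order. A nonempty chain is bounded by its
  pointwise infimum, which is finite because every sublinear \<open>q \<le> p\<close> satisfies
  \<open>- p (- x) \<le> q x\<close>.\<close>

lemma minimal_sublinear:
  assumes p: "sublinear p"
  obtains q where "sublinear q" "\<And>x. q x \<le> p x"
    "\<And>q'. sublinear q' \<Longrightarrow> (\<And>x. q' x \<le> q x) \<Longrightarrow> q' = q"
proof -
  define A where "A = {q. sublinear q \<and> q \<le> p}"
  \<comment> \<open>The order is reversed, so that a maximal element for Zorn's lemma is a minimal
    functional.\<close>
  define P where "P = (\<lambda>q r :: 'a \<Rightarrow> real. r \<le> q)"
  have "\<exists>m\<in>A. \<forall>a\<in>A. P m a \<longrightarrow> a = m"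
  proof (rule predicate_Zorn)
    show "partial_order_on A (relation_of P A)"
      by (auto simp: P_def partial_order_on_def preorder_on_def refl_on_def trans_def antisym_def
          relation_of_def intro: order_trans)
  next
    fix C assume C: "C \<in> Chains (relation_of P A)"
    show "\<exists>u\<in>A. \<forall>a\<in>C. P a u"
    proof (cases "C = {}")
      case True
      thus ?thesis using p by (auto simp: A_def)
    next
      case False
      have CA: "C \<subseteq> A" using C by (auto simp: Chains_def relation_of_def)
      have sub: "sublinear q" "q x \<le> p x" if "q \<in> C" for q x
        using that CA by (auto simp: A_def le_fun_def)
      have total: "q \<le> r \<or> r \<le> q" if "q \<in> C" "r \<in> C" for q r
        using C that by (auto simp: Chains_def relation_of_def P_def)
      define u where "u x = (INF q\<in>C. q x)" for x
      have bdd: "bdd_below ((\<lambda>q. q x) ` C)" for x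
      proof (rule bdd_belowI2)
        fix q assume "q \<in> C"
        show "- p (- x) \<le> q x"
          using sublinear_minus[OF sub(1), OF \<open>q \<in> C\<close>, of x] sub(2)[OF \<open>q \<in> C\<close>, of "- x"] by linarith
      qed
      have lower: "u x \<le> q x" if "q \<in> C" for q x
        unfolding u_def by (rule cINF_lower[OF bdd that])
      have "sublinear u"
        unfolding sublinear_def
      proof (intro conjI allI impI)
        fix x y
        have "u (x + y) - r y \<le> q x" if "q \<in> C" "r \<in> C" for q r
        proof -
          \<comment> \<open>Two members of a chain are comparable, so the smaller one can serve at
            \<open>x\<close> and at \<open>y\<close> simultaneously. This is what makes the infimum
            subadditive.\<close>
          obtain m where "m \<in> C" "m \<le> q" "m \<le> r" using total[OF \<open>q \<in> C\<close> \<open>r \<in> C\<close>] \<open>q \<in> C\<close> \<open>r \<in> C\<close> by blast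
          hence "m x \<le> q x" "m y \<le> r y" by (auto simp: le_fun_def)
          with lower[OF \<open>m \<in> C\<close>, of "x + y"] sublinear_add[OF sub(1), OF \<open>m \<in> C\<close>, of x y]
          show ?thesis by linarith
        qed
        hence "u (x + y) - r y \<le> u x" if "r \<in> C" for r
          unfolding u_def[of x] using that False by (intro cINF_greatest) auto
        hence "u (x + y) - u x \<le> r y" if "r \<in> C" for r
          using that by (fastforce simp: algebra_simps)
        hence "u (x + y) - u x \<le> u y"
          unfolding u_def[of y] using False by (intro cINF_greatest) auto
        thus "u (x + y) \<le> u x + u y" by simp
      next
        fix c :: real and x assume c: "0 < c"
        have le: "u (c *\<^sub>R x) \<le> c * u x" if c: "0 < c" for c x
        proof -
          have "u (c *\<^sub>R x) / c \<le> q x" if "q \<in> C" for q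
            using lower[OF that, of "c *\<^sub>R x"] sublinear_scale[OF sub(1), OF that c, of x] c
            by (simp add: field_simps)
          hence "u (c *\<^sub>R x) / c \<le> u x"
            unfolding u_def[of x] using False by (intro cINF_greatest) auto
          thus ?thesis using c by (simp add: field_simps)
        qed
        have "u (inverse c *\<^sub>R (c *\<^sub>R x)) \<le> inverse c * u (c *\<^sub>R x)"
          using c by (intro le) simp
        hence "c * u x \<le> u (c *\<^sub>R x)" using c by (simp add: field_simps)
        with le[OF c, of x] show "u (c *\<^sub>R x) = c * u x" by simp
      qed
      moreover have "u \<le> p"
      proof -
        obtain q where "q \<in> C" using False by blast
        thus ?thesis using lower[of q] sub(2)[of q] by (auto simp: le_fun_def intro: order_trans)
      qed
      ultimately show ?thesis using lower by (auto simp: A_def P_def le_fun_def)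
    qed
  qed
  then obtain q where q: "q \<in> A" "\<And>a. a \<in> A \<Longrightarrow> a \<le> q \<Longrightarrow> a = q" by (auto simp: P_def)
  show ?thesis
  proof (rule that)
    fix q' assume "sublinear q'" "\<And>x. q' x \<le> q x"
    thus "q' = q" using q(1) by (intro q(2)) (auto simp: A_def le_fun_def intro: order_trans)
  qed (use q(1) in \<open>auto simp: A_def le_fun_def\<close>)
qed

text \<open>A minimal sublinear functional is linear: its shift in direction \<open>y\<close> lies
  below it, hence equals it, and this gives \<open>q x + q y \<le> q (x + y)\<close>. Additivity
  makes \<open>q\<close> odd, which extends homogeneity to negative scalars.\<close>

theorem Hahn_Banach_sublinear:
  assumes "sublinear p"
  obtains L where "linear L" "\<And>x. L x \<le> p x"
proof -
  obtain q where q: "sublinear q" "\<And>x. q x \<le> p x"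
    and minimal: "\<And>q'. sublinear q' \<Longrightarrow> (\<And>x. q' x \<le> q x) \<Longrightarrow> q' = q"
    using minimal_sublinear[OF assms] by metis
  have add: "q (x + y) = q x + q y" for x y
  proof -
    obtain q' where "sublinear q'" "\<And>x. q' x \<le> q x" "\<And>x. q' x \<le> q (x + y) - q y"
      using sublinear_shift[OF q(1)] by metis
    with minimal have "q x \<le> q (x + y) - q y" by metis
    with sublinear_add[OF q(1), of x y] show ?thesis by simp
  qed
  have minus: "q (- x) = - q x" for x
    using add[of x "- x"] sublinear_zero[OF q(1)] by simp
  have "q (c *\<^sub>R x) = c * q x" for c x
  proof (cases "0 \<le> c")
    case True
    thus ?thesis by (rule sublinear_scale_nonneg[OF q(1)])
  next
    case False
    thus ?thesis using minus[of "(- c) *\<^sub>R x"] sublinear_scale[OF q(1), of "- c" x] by simp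
  qed
  with add have "linear q" by (auto intro: linearI)
  with q(2) that show ?thesis by blast
qed

text \<open>The directional derivatives of \<open>p\<close> at \<open>g\<close> form a sublinear functional.\<close>

theorem convex_subgradient_exists:
  fixes p :: "'a::real_vector \<Rightarrow> real"
  assumes convex: "convex_on UNIV p"
  obtains L where "linear L" "\<And>h. p g + L (h - g) \<le> p h"
proof -
  define d where "d h t = (p (g + t *\<^sub>R h) - p g) / t" for h t
  define q where "q h = (INF t\<in>{0<..}. d h t)" for h
  \<comment> \<open>The weights \<open>t / (s + t)\<close> and \<open>s / (s + t)\<close> bring
    \<open>s\<close> and \<open>t\<close> to the common step \<open>s * t / (s + t)\<close>, so
    convexity compares the three difference quotients. Subadditivity of their infimum follows at
    once.\<close>
  have combine: "d (h + k) (s * t / (s + t)) \<le> d h s + d k t" if "0 < s" "0 < t" for h k s t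
  proof -
    define a where "a = s / (s + t)"
    have a: "0 \<le> a" "a \<le> 1" "1 - a = t / (s + t)" using that by (auto simp: a_def field_simps)
    have "g + (s * t / (s + t)) *\<^sub>R (h + k) = (1 - a) *\<^sub>R (g + s *\<^sub>R h) + a *\<^sub>R (g + t *\<^sub>R k)"
    proof -
      have "(1 - a) * s = s * t / (s + t)" "a * t = s * t / (s + t)"
        unfolding a(3) by (auto simp: a_def)
      hence "(1 - a) *\<^sub>R (g + s *\<^sub>R h) + a *\<^sub>R (g + t *\<^sub>R k)
          = ((1 - a) + a) *\<^sub>R g + (s * t / (s + t)) *\<^sub>R (h + k)"
        by (simp only: scaleR_add_right scaleR_add_left scaleR_scaleR add_ac)
      thus ?thesis by simp
    qed
    hence "p (g + (s * t / (s + t)) *\<^sub>R (h + k)) \<le> (1 - a) * p (g + s *\<^sub>R h) + a * p (g + t *\<^sub>R k)"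
      using convex_onD[OF convex a(1,2)] by simp
    hence "p (g + (s * t / (s + t)) *\<^sub>R (h + k)) - p g
        \<le> (1 - a) * (p (g + s *\<^sub>R h) - p g) + a * (p (g + t *\<^sub>R k) - p g)"
      by (simp add: algebra_simps)
    hence "d (h + k) (s * t / (s + t))
        \<le> ((1 - a) * (p (g + s *\<^sub>R h) - p g) + a * (p (g + t *\<^sub>R k) - p g)) / (s * t / (s + t))"
      unfolding d_def using that by (intro divide_right_mono) auto
    also have "\<dots> = d h s + d k t"
    proof -
      have "((1 - a) * u + a * v) / (s * t / (s + t)) = u / s + v / t" for u v
      proof -
        have "(1 - a) / (s * t / (s + t)) = 1 / s" "a / (s * t / (s + t)) = 1 / t"
          unfolding a(3) unfolding a_def using that by auto
        moreover have "((1 - a) * u + a * v) / m = (1 - a) / m * u + a / m * v" for m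
          by (simp add: add_divide_distrib)
        ultimately show ?thesis by (simp only:) simp
      qed
      thus ?thesis by (simp add: d_def)
    qed
    finally show ?thesis .
  qed
  have zero: "d 0 t = 0" for t by (simp add: d_def)
  \<comment> \<open>Opposite directions add up to \<open>0\<close>, where every difference quotient
    vanishes; \<open>combine\<close> then bounds \<open>d h t\<close> from below.\<close>
  have bdd: "bdd_below (d h ` {0<..})" for h
  proof (rule bdd_belowI2)
    fix t :: real assume "t \<in> {0<..}"
    with combine[of t 1 h "- h"] zero show "- d (- h) 1 \<le> d h t" by simp
  qed
  have lower: "q h \<le> d h t" if "0 < t" for h t
    unfolding q_def using that by (intro cINF_lower[OF bdd]) auto
  have "sublinear q"
    unfolding sublinear_def
  proof (intro conjI allI impI)
    fix x y
    have "q (x + y) - d y t \<le> d x s" if "0 < s" "0 < t" for s t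
      using lower[of "s * t / (s + t)" "x + y"] combine[OF that, of x y] that by simp
    hence "q (x + y) - d y t \<le> q x" if "0 < t" for t
      unfolding q_def[of x] using that by (intro cINF_greatest) auto
    hence "q (x + y) - q x \<le> d y t" if "0 < t" for t
      using that by (fastforce simp: algebra_simps)
    hence "q (x + y) - q x \<le> q y"
      unfolding q_def[of y] by (intro cINF_greatest) auto
    thus "q (x + y) \<le> q x + q y" by simp
  next
    fix c :: real and x assume c: "0 < c"
    have le: "q (c *\<^sub>R x) \<le> c * q x" if c: "0 < c" for c x
    proof -
      have "q (c *\<^sub>R x) / c \<le> d x t" if "0 < t" for t
      proof -
        have "d (c *\<^sub>R x) (t / c) = c * d x t" using c by (simp add: d_def)
        with lower[of "t / c" "c *\<^sub>R x"] that c show ?thesis by (simp add: field_simps)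
      qed
      hence "q (c *\<^sub>R x) / c \<le> q x"
        unfolding q_def[of x] by (intro cINF_greatest) auto
      thus ?thesis using c by (simp add: field_simps)
    qed
    have "q (inverse c *\<^sub>R (c *\<^sub>R x)) \<le> inverse c * q (c *\<^sub>R x)"
      using c by (intro le) simp
    hence "c * q x \<le> q (c *\<^sub>R x)" using c by (simp add: field_simps)
    with le[OF c, of x] show "q (c *\<^sub>R x) = c * q x" by simp
  qed
  then obtain L where L: "linear L" "\<And>x. L x \<le> q x" using Hahn_Banach_sublinear by metis
  have "p g + L (h - g) \<le> p h" for h
    using L(2)[of "h - g"] lower[of 1 "h - g"] by (simp add: d_def)
  with L(1) that show ?thesis by blast
qed

subsection \<open>Weak sequential compactness\<close>

text \<open>Only the digits 0 and 1 are used in base 3, as in a Cantor set. Hence later digits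
  cannot compensate for a differing earlier one, and close codes have equal initial digits.\<close>

definition ternary_code :: "(nat \<Rightarrow> bool) \<Rightarrow> real" where
  "ternary_code b = (\<Sum>n. of_bool (b n) * (1/3) ^ n)"

lemma summable_ternary_code: "summable (\<lambda>n. of_bool (b n) * (1/3::real) ^ n)"
  by (rule summable_comparison_test'[of "\<lambda>n. (1/3::real) ^ n" 0])
     (auto intro: summable_geometric)

lemma ternary_code_bounds: "0 \<le> ternary_code b" "ternary_code b \<le> 2"
proof -
  show "0 \<le> ternary_code b"
    unfolding ternary_code_def by (intro suminf_nonneg summable_ternary_code) auto
  have "ternary_code b \<le> (\<Sum>n. (1/3::real) ^ n)"
    unfolding ternary_code_def
    by (intro suminf_le summable_ternary_code) (auto intro: summable_geometric)
  also have "\<dots> = 3/2" by (subst suminf_geometric) auto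
  finally show "ternary_code b \<le> 2" by simp
qed

text \<open>If \<open>j\<close> is the first differing position, it contributes
  \<open>(1/3) ^ j\<close> to the difference and all later positions together at most half of that.
  The remainder is at least \<open>(1/3) ^ Suc j\<close>, and \<open>j < N\<close>.\<close>

lemma ternary_code_gap:
  assumes "k < N" "b k \<noteq> b' k"
  shows "(1/3) ^ N \<le> \<bar>ternary_code b - ternary_code b'\<bar>"
proof -
  define j where "j = (LEAST i. b i \<noteq> b' i)"
  have j: "b j \<noteq> b' j" unfolding j_def using assms(2) by (rule LeastI)
  have less: "b i = b' i" if "i < j" for i using not_less_Least that unfolding j_def by blast
  have "j \<le> k" unfolding j_def using assms(2) by (rule Least_le)
  with assms(1) have "j < N" by simp
  define d where "d n = (of_bool (b n) - of_bool (b' n)) * (1/3::real) ^ n" for n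
  have d: "d = (\<lambda>n. of_bool (b n) * (1/3) ^ n - of_bool (b' n) * (1/3) ^ n)"
    by (auto simp: d_def fun_eq_iff algebra_simps)
  have sd: "summable d" unfolding d by (intro summable_diff summable_ternary_code)
  have "ternary_code b - ternary_code b' = suminf d"
    unfolding ternary_code_def d by (intro suminf_diff summable_ternary_code)
  also have "\<dots> = (\<Sum>n. d (n + Suc j)) + sum d {..<Suc j}"
    by (rule suminf_split_initial_segment[OF sd])
  also have "sum d {..<Suc j} = d j" using less by (simp add: d_def)
  finally have eq: "ternary_code b - ternary_code b' = (\<Sum>n. d (n + Suc j)) + d j" .
  have sg: "summable (\<lambda>n. (1/3::real) ^ (n + Suc j))"
    unfolding power_add by (intro summable_mult2 summable_geometric) auto
  have le: "norm (d (n + Suc j)) \<le> (1/3) ^ (n + Suc j)" for n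
    by (auto simp: d_def abs_mult)
  have "norm (\<Sum>n. d (n + Suc j)) \<le> (\<Sum>n. (1/3::real) ^ (n + Suc j))"
    by (rule order_trans[OF summable_norm suminf_le])
       (use le sg in \<open>auto intro: summable_comparison_test'[OF sg, of 0]\<close>)
  also have "\<dots> = (\<Sum>n. (1/3::real) ^ n) * (1/3) ^ Suc j"
    unfolding power_add by (rule suminf_mult2[symmetric]) (auto intro: summable_geometric)
  also have "\<dots> = (1/3) ^ j / 2" by (subst suminf_geometric) auto
  finally have "\<bar>\<Sum>n. d (n + Suc j)\<bar> \<le> (1/3) ^ j / 2" by simp
  moreover have "\<bar>d j\<bar> = (1/3) ^ j" using j by (auto simp: d_def abs_mult)
  ultimately have "(1/3) ^ j / 2 \<le> \<bar>ternary_code b - ternary_code b'\<bar>"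
    unfolding eq by linarith
  moreover have "(1/3::real) ^ N \<le> (1/3) ^ Suc j"
    using \<open>j < N\<close> by (intro power_decreasing) auto
  moreover have "(1/3::real) ^ Suc j \<le> (1/3) ^ j / 2" by simp
  ultimately show ?thesis by linarith
qed

text \<open>The sets enumerate the balls of radius \<open>1 / Suc m\<close> around finite nets, for
  all \<open>m\<close>. Points with the same membership in the balls of one level \<open>m\<close>
  share a ball of that level, so their distance is below \<open>2 / Suc m\<close>.\<close>

lemma separating_open_sequence:
  assumes "compact (UNIV :: 'y::metric_space set)"
  obtains V :: "nat \<Rightarrow> 'y::metric_space set" where "\<And>n. open (V n)"
    "\<And>e. 0 < e \<Longrightarrow> \<exists>N. \<forall>y y'. (\<forall>k<N. y \<in> V k \<longleftrightarrow> y' \<in> V k) \<longrightarrow> dist y y' < e"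
proof -
  have "\<exists>k. finite k \<and> (UNIV :: 'y set) \<subseteq> (\<Union>x\<in>k. ball x (1 / Suc m))" for m
    using assms unfolding compact_eq_totally_bounded
    by (metis of_nat_0_less_iff zero_less_Suc zero_less_divide_1_iff)
  then obtain A :: "nat \<Rightarrow> 'y set"
    where A: "\<And>m. finite (A m)" "\<And>m. UNIV \<subseteq> (\<Union>x\<in>A m. ball x (1 / Suc m))" by metis
  define D where "D = (SIGMA m:UNIV. A m)"
  have "countable D" unfolding D_def using A(1) by (intro countable_SIGMA) (auto intro: countable_finite)
  have "A 0 \<noteq> {}" using A(2)[of 0] by auto
  hence "D \<noteq> {}" unfolding D_def by auto
  define p where "p = from_nat_into D"
  define V where "V n = ball (snd (p n)) (1 / Suc (fst (p n)))" for n
  show ?thesis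
  proof (rule that)
    show "open (V n)" for n by (simp add: V_def)
  next
    fix e :: real assume "0 < e"
    then obtain m where "1 / Suc m < e / 2"
      using nat_approx_posE[of "e / 2"] by auto
    hence m: "2 / Suc m < e" by (simp add: field_simps)
    have "\<exists>n. p n = (m, a)" if "a \<in> A m" for a
      using that from_nat_into_to_nat_on[OF \<open>countable D\<close>, of "(m, a)"] unfolding p_def D_def by auto
    then obtain i where i: "\<And>a. a \<in> A m \<Longrightarrow> p (i a) = (m, a)" by metis
    \<comment> \<open>Level \<open>m\<close> has finitely many balls, so an initial segment of the
      enumeration contains them all.\<close>
    define N where "N = Suc (Max (i ` A m))"
    have iN: "i a < N" if "a \<in> A m" for a
      unfolding N_def using A(1) that by (auto simp: less_Suc_eq_le)
    have "dist y y' < e" if same: "\<forall>k<N. y \<in> V k \<longleftrightarrow> y' \<in> V k" for y y'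
    proof -
      obtain a where a: "a \<in> A m" "y \<in> ball a (1 / Suc m)" using A(2)[of m] by blast
      have V: "V (i a) = ball a (1 / Suc m)" using i[OF a(1)] by (simp add: V_def)
      hence "y' \<in> ball a (1 / Suc m)" using same iN[OF a(1)] a(2) by blast
      with a(2) have "dist y y' < 1 / Suc m + 1 / Suc m"
        by (metis dist_triangle_less_add dist_commute mem_ball)
      with m show ?thesis by simp
    qed
    thus "\<exists>N. \<forall>y y'. (\<forall>k<N. y \<in> V k \<longleftrightarrow> y' \<in> V k) \<longrightarrow> dist y y' < e" by blast
  qed
qed

text \<open>A point is coded by its membership in the separating sets. The code is in general only
  Borel, but by the digit gap close codes force close points, so its inverse is uniformly
  continuous.\<close>

lemma compact_metric_borel_embedding:
  assumes "compact (UNIV :: 'y::metric_space set)"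
  obtains s :: "'y::metric_space \<Rightarrow> real" where "s \<in> borel_measurable borel" "\<And>y. 0 \<le> s y" "\<And>y. s y \<le> 2"
    "\<And>e. 0 < e \<Longrightarrow> \<exists>d>0. \<forall>y y'. \<bar>s y - s y'\<bar> < d \<longrightarrow> dist y y' < e"
proof -
  obtain V :: "nat \<Rightarrow> 'y set" where V: "\<And>n. open (V n)"
    "\<And>e. 0 < e \<Longrightarrow> \<exists>N. \<forall>y y'. (\<forall>k<N. y \<in> V k \<longleftrightarrow> y' \<in> V k) \<longrightarrow> dist y y' < e"
    using separating_open_sequence[OF assms] by metis
  define s where "s y = ternary_code (\<lambda>n. y \<in> V n)" for y
  show ?thesis
  proof (rule that)
    have [measurable]: "V n \<in> sets borel" for n using V(1) by auto
    have "s = (\<lambda>y. \<Sum>n. indicator (V n) y * (1/3) ^ n)"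
      by (auto simp: s_def ternary_code_def fun_eq_iff indicator_def)
    thus "s \<in> borel_measurable borel" by simp
  next
    fix e :: real assume "0 < e"
    then obtain N where N: "\<forall>y y'. (\<forall>k<N. y \<in> V k \<longleftrightarrow> y' \<in> V k) \<longrightarrow> dist y y' < e"
      using V(2) by metis
    have "dist y y' < e" if "\<bar>s y - s y'\<bar> < (1/3) ^ N" for y y'
      using N that ternary_code_gap[of _ N "\<lambda>n. y \<in> V n" "\<lambda>n. y' \<in> V n"] unfolding s_def
      by (meson not_le)
    thus "\<exists>d>0. \<forall>y y'. \<bar>s y - s y'\<bar> < d \<longrightarrow> dist y y' < e"
      by (intro exI[of _ "(1/3) ^ N"]) auto
  qed (auto simp: s_def ternary_code_bounds)
qed

text \<open>Limits of image measures may charge limit points of the range, so the inverse is needed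
  on the closure. At \<open>c\<close> its value is a cluster point of points whose codes tend to
  \<open>c\<close>; it exists by compactness, and the modulus shows that all points with codes near
  \<open>c\<close> are close to it.\<close>

lemma extend_inverse_to_closure:
  fixes s :: "'y::metric_space \<Rightarrow> real"
  assumes "compact (UNIV :: 'y set)"
    and modulus: "\<And>e. 0 < e \<Longrightarrow> \<exists>d>0. \<forall>y y'. \<bar>s y - s y'\<bar> < d \<longrightarrow> dist y y' < e"
  obtains \<phi> where "continuous_on (closure (range s)) \<phi>" "\<And>y. \<phi> (s y) = y"
proof -
  have "\<exists>l. \<forall>e>0. \<exists>d>0. \<forall>y. \<bar>s y - c\<bar> < d \<longrightarrow> dist y l < e" if c: "c \<in> closure (range s)" for c
  proof -
    obtain z where z: "\<And>n::nat. z n \<in> range s" "z \<longlonglongrightarrow> c"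
      using c by (auto simp: closure_sequential)
    hence "\<forall>n. \<exists>y. z n = s y" by auto
    then obtain v where v: "\<And>n. z n = s (v n)" by metis
    obtain l r where r: "strict_mono r" "(v \<circ> r) \<longlonglongrightarrow> l"
      using assms(1)[unfolded compact_def, rule_format, of v] by auto
    have zr: "(z \<circ> r) \<longlonglongrightarrow> c" using z(2) r(1) by (rule LIMSEQ_subseq_LIMSEQ)
    have "\<exists>d>0. \<forall>y. \<bar>s y - c\<bar> < d \<longrightarrow> dist y l < e" if "e > 0" for e
    proof -
      obtain d where d: "d > 0" "\<And>y y'. \<bar>s y - s y'\<bar> < d \<Longrightarrow> dist y y' < e/2"
        using modulus[of "e/2"] \<open>e > 0\<close> by auto
      have "\<forall>\<^sub>F n in sequentially. dist ((z \<circ> r) n) c < d/2" "\<forall>\<^sub>F n in sequentially. dist ((v \<circ> r) n) l < e/2"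
        using tendstoD[OF zr, of "d/2"] tendstoD[OF r(2), of "e/2"] d(1) \<open>e > 0\<close> by simp_all
      hence "\<forall>\<^sub>F n in sequentially. dist ((z \<circ> r) n) c < d/2 \<and> dist ((v \<circ> r) n) l < e/2"
        by (rule eventually_conj)
      then obtain n where n: "dist ((z \<circ> r) n) c < d/2" "dist ((v \<circ> r) n) l < e/2"
        by (auto simp: eventually_sequentially)
      have "dist y l < e" if "\<bar>s y - c\<bar> < d/2" for y
      proof -
        have "\<bar>s (v (r n)) - c\<bar> < d/2" using n(1) by (simp add: dist_real_def v)
        with that have "\<bar>s y - s (v (r n))\<bar> < d" by linarith
        from d(2)[OF this] n(2) show ?thesis
          using dist_triangle[of y l "v (r n)"] by auto
      qed
      with d(1) show ?thesis by (intro exI[of _ "d/2"]) auto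
    qed
    thus ?thesis by blast
  qed
  then obtain \<phi> where \<phi>: "\<And>c e. c \<in> closure (range s) \<Longrightarrow> 0 < e \<Longrightarrow>
      \<exists>d>0. \<forall>y. \<bar>s y - c\<bar> < d \<longrightarrow> dist y (\<phi> c) < e" by metis
  show ?thesis
  proof (rule that)
    fix y
    have "s y \<in> closure (range s)" using closure_subset by fastforce
    have "dist y (\<phi> (s y)) < e" if "0 < e" for e
      using \<phi>[OF \<open>s y \<in> _\<close> that] by fastforce
    thus "\<phi> (s y) = y" by (metis zero_less_dist_iff less_irrefl)
  next
    show "continuous_on (closure (range s)) \<phi>"
      unfolding continuous_on_iff
    proof (intro ballI allI impI)
      fix c e :: real assume c: "c \<in> closure (range s)" and "0 < e"
      then obtain d where d: "d > 0" "\<And>y. \<bar>s y - c\<bar> < d \<Longrightarrow> dist y (\<phi> c) < e/2"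
        using \<phi>[OF c, of "e/2"] by auto
      have "dist (\<phi> c') (\<phi> c) < e" if c': "c' \<in> closure (range s)" "dist c' c < d/2" for c'
      proof -
        obtain d' where d': "d' > 0" "\<And>y. \<bar>s y - c'\<bar> < d' \<Longrightarrow> dist y (\<phi> c') < e/2"
          using \<phi>[OF c'(1), of "e/2"] \<open>0 < e\<close> by auto
        obtain y where y: "dist (s y) c' < min d' (d/2)"
          using c'(1) d(1) d'(1) unfolding closure_approachable by (metis half_gt_zero imageE min_less_iff_conj)
        have "dist y (\<phi> c') < e/2" using d'(2) y by (auto simp: dist_real_def)
        moreover have "\<bar>s y - c\<bar> < d" using y c'(2) unfolding dist_real_def by linarith
        hence "dist y (\<phi> c) < e/2" by (rule d(2))
        ultimately show ?thesis by (metis dist_commute dist_triangle_half_r)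
      qed
      with d(1) show "\<exists>d>0. \<forall>x'\<in>closure (range s). dist x' c < d \<longrightarrow> dist (\<phi> x') (\<phi> c) < e"
        by (intro exI[of _ "d/2"]) auto
    qed
  qed
qed

section \<open>Extraction of weak limits\<close>

lemma continuous_bounded_on_compact_type:
  fixes g :: "'y::metric_space \<Rightarrow> real"
  assumes "compact (UNIV :: 'y set)" "continuous_on UNIV g"
  obtains B where "0 \<le> B" "\<And>y. \<bar>g y\<bar> \<le> B"
proof -
  have "bounded (range g)" using compact_continuous_image[OF assms(2,1)] by (rule compact_imp_bounded)
  then obtain B where "\<And>y. \<bar>g y\<bar> \<le> B" by (auto simp: bounded_iff)
  moreover from this have "0 \<le> B" using abs_ge_zero order_trans by blast
  ultimately show ?thesis using that by blast
qed

text \<open>The images under \<open>s\<close> are tight on the line, so Helly's theorem provides a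
  weak limit \<open>M\<close> along a subsequence. It is carried by the closure \<open>C\<close> of
  the range and is pushed back to the space by the extended inverse \<open>\<phi>\<close>.\<close>

theorem prob_measures_weak_seq_compact:
  fixes \<sigma> :: "nat \<Rightarrow> 'y::metric_space measure"
  assumes Y: "compact (UNIV :: 'y set)" and \<sigma>: "\<And>n. \<sigma> n \<in> prob_measures"
  obtains r \<tau> where "strict_mono r" "\<tau> \<in> prob_measures"
    "\<And>g::'y \<Rightarrow> real. continuous_on UNIV g \<Longrightarrow> (\<lambda>n. \<integral>y. g y \<partial>\<sigma> (r n)) \<longlonglongrightarrow> (\<integral>y. g y \<partial>\<tau>)"
proof -
  obtain s :: "'y \<Rightarrow> real" where s[measurable]: "s \<in> borel_measurable borel"
    and s_bounds: "\<And>y. 0 \<le> s y" "\<And>y. s y \<le> 2"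
    and modulus: "\<And>e. 0 < e \<Longrightarrow> \<exists>d>0. \<forall>y y'. \<bar>s y - s y'\<bar> < d \<longrightarrow> dist y y' < e"
    using compact_metric_borel_embedding[OF Y] by metis
  define C where "C = closure (range s)"
  obtain \<phi> where \<phi>: "continuous_on C \<phi>" "\<And>y. \<phi> (s y) = y"
    unfolding C_def using extend_inverse_to_closure[OF Y modulus] by metis
  have sC: "s y \<in> C" for y unfolding C_def using closure_subset by fastforce
  have "closed C" by (simp add: C_def)
  have [measurable]: "C \<in> sets borel" using \<open>closed C\<close> by simp
  have prob: "prob_space (\<sigma> n)" and [measurable_cong]: "sets (\<sigma> n) = sets borel" for n
    using \<sigma> by (auto simp: prob_measures_def)
  define \<mu> where "\<mu> n = distr (\<sigma> n) borel s" for n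
  have s\<sigma>: "s \<in> borel_measurable (\<sigma> n)" for n by measurable
  have rd: "real_distribution (\<mu> n)" for n
    unfolding real_distribution_def real_distribution_axioms_def
    using prob_space.prob_space_distr[OF prob s\<sigma>] by (simp add: \<mu>_def)
  have int_\<mu>: "(\<integral>x. f x \<partial>\<mu> n) = (\<integral>y. f (s y) \<partial>\<sigma> n)" if "f \<in> borel_measurable borel"
    for f :: "real \<Rightarrow> real" and n
    unfolding \<mu>_def by (rule integral_distr[OF s\<sigma> that])
  \<comment> \<open>All image measures live on \<open>[0, 2]\<close>, so a single interval works for
    every \<open>e\<close>.\<close>
  have tight: "tight \<mu>"
    unfolding tight_def
  proof (intro conjI allI impI rd)
    fix e :: real assume "0 < e"
    have "measure (\<mu> n) {-1<..3} = 1" for n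
    proof -
      have *: "s -` {-1<..3} \<inter> space (\<sigma> n) = space (\<sigma> n)"
      proof -
        have "-1 < s y" "s y \<le> 3" for y using s_bounds[of y] by linarith+
        thus ?thesis by auto
      qed
      show ?thesis
        unfolding \<mu>_def using measure_distr[OF s\<sigma>, of "{-1<..3}" n] prob_space.prob_space[OF prob]
        by (simp add: *)
    qed
    thus "\<exists>a b. a < b \<and> (\<forall>n. 1 - e < measure (\<mu> n) {a<..b})"
      using \<open>0 < e\<close> by (intro exI[of _ "-1"] exI[of _ "3"]) auto
  qed
  obtain r M where r: "strict_mono (r :: nat \<Rightarrow> nat)" and M: "real_distribution M"
    and conv: "weak_conv_m (\<mu> \<circ> id \<circ> r) M"
    using tight_imp_convergent_subsubsequence[OF tight strict_mono_id] by auto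
  interpret M: real_distribution M by (rule M)
  have conv_int: "(\<lambda>n. \<integral>x. f x \<partial>\<mu> (r n)) \<longlonglongrightarrow> (\<integral>x. f x \<partial>M)"
    if "continuous_on UNIV f" "\<And>x. \<bar>f x\<bar> \<le> B" for f :: "real \<Rightarrow> real" and B
    using weak_conv_imp_integral_bdd_continuous_conv[of "\<mu> \<circ> id \<circ> r" M f B] rd M conv that
    by (auto simp: continuous_on_eq_continuous_at)
  have AE_C: "AE x in M. x \<in> C"
  proof -
    \<comment> \<open>A bounded continuous test function whose zero set is \<open>C\<close>: its
      integral vanishes for all image measures, hence for \<open>M\<close>, and being nonnegative it
      is zero \<open>M\<close>-almost everywhere.\<close>
    define f where "f x = min 1 (infdist x C)" for x
    have f: "continuous_on UNIV f" "\<And>x. \<bar>f x\<bar> \<le> 1" "\<And>x. 0 \<le> f x"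
      by (auto simp: f_def infdist_nonneg intro!: continuous_intros)
    have [measurable]: "f \<in> borel_measurable borel"
      using f(1) by (rule borel_measurable_continuous_onI)
    have "(\<integral>x. f x \<partial>\<mu> n) = 0" for n
      using sC by (subst int_\<mu>) (auto simp: f_def)
    with conv_int[OF f(1,2)] have "(\<integral>x. f x \<partial>M) = 0"
      by (simp add: LIMSEQ_const_iff)
    moreover have "integrable M f"
      by (rule M.integrable_const_bound[of _ 1]) (use f in auto)
    ultimately have "AE x in M. f x = 0"
      using integral_nonneg_eq_0_iff_AE[of M f] f(3) by auto
    moreover have "x \<in> C" if "f x = 0" for x
      using that in_closed_iff_infdist_zero[OF \<open>closed C\<close>, of x] sC by (auto simp: f_def min_def split: if_splits)
    ultimately show ?thesis by (auto elim: eventually_mono)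
  qed
  \<comment> \<open>The value chosen off \<open>C\<close> has no influence, since \<open>M\<close>
    is carried by \<open>C\<close>.\<close>
  define \<psi> where "\<psi> x = (if x \<in> C then \<phi> x else undefined)" for x
  have \<psi>[measurable]: "\<psi> \<in> measurable borel borel"
    unfolding \<psi>_def
    using borel_measurable_continuous_on_restrict[OF \<phi>(1)]
    by (subst measurable_If_restrict_space_iff) auto
  define \<tau> where "\<tau> = distr M borel \<psi>"
  have \<psi>M: "\<psi> \<in> measurable M borel" by measurable
  have "\<tau> \<in> prob_measures"
    unfolding prob_measures_def \<tau>_def using M.prob_space_distr[OF \<psi>M] by simp
  moreover have "(\<lambda>n. \<integral>y. g y \<partial>\<sigma> (r n)) \<longlonglongrightarrow> (\<integral>y. g y \<partial>\<tau>)"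
    if g: "continuous_on UNIV g" for g :: "'y \<Rightarrow> real"
  proof -
    obtain B where B: "0 \<le> B" "\<And>y. \<bar>g y\<bar> \<le> B"
      using continuous_bounded_on_compact_type[OF Y g] by metis
    have cg: "continuous_on C (\<lambda>x. g (\<phi> x))"
      using continuous_on_compose2[OF g \<phi>(1)] by auto
    \<comment> \<open>Weak convergence on the line needs a test function on all of the line;
      Tietze's theorem extends \<open>g \<circ> \<phi>\<close> from \<open>C\<close> with the same
      bound.\<close>
    obtain G where G: "continuous_on UNIV G" "\<And>x. x \<in> C \<Longrightarrow> G x = g (\<phi> x)" "\<And>x. \<bar>G x\<bar> \<le> B"
      using Tietze[OF cg _ B(1), of UNIV] \<open>closed C\<close> B(2) by auto
    have [measurable]: "G \<in> borel_measurable borel" "g \<in> borel_measurable borel"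
      using G(1) g by (auto intro: borel_measurable_continuous_onI)
    have "(\<integral>x. G x \<partial>\<mu> n) = (\<integral>y. g y \<partial>\<sigma> n)" for n
      by (subst int_\<mu>) (auto simp: G(2)[OF sC] \<phi>(2))
    moreover have "(\<integral>y. g y \<partial>\<tau>) = (\<integral>x. g (\<psi> x) \<partial>M)"
      unfolding \<tau>_def by (rule integral_distr[OF \<psi>M]) measurable
    moreover have "\<dots> = (\<integral>x. G x \<partial>M)"
    proof (rule integral_cong_AE)
      show "(\<lambda>x. g (\<psi> x)) \<in> borel_measurable M" "G \<in> borel_measurable M" by measurable
      show "AE x in M. g (\<psi> x) = G x"
        using AE_C G(2) by (auto elim: eventually_mono simp: \<psi>_def)
    qed
    ultimately show ?thesis using conv_int[OF G(1,3)] by simp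
  qed
  ultimately show ?thesis using that r by blast
qed

subsection \<open>Riesz representation\<close>

lemma prob_measures_prob_space: "\<sigma> \<in> prob_measures \<Longrightarrow> prob_space \<sigma>"
  and prob_measures_sets: "\<sigma> \<in> prob_measures \<Longrightarrow> sets \<sigma> = sets borel"
  by (auto simp: prob_measures_def)

lemma continuous_integrable_prob_measures:
  fixes g :: "'y::metric_space \<Rightarrow> real"
  assumes "compact (UNIV :: 'y set)" "continuous_on UNIV g" "\<sigma> \<in> prob_measures"
  shows "integrable \<sigma> g"
proof -
  interpret prob_space \<sigma> using assms(3) by (rule prob_measures_prob_space)
  obtain B where "\<And>y. \<bar>g y\<bar> \<le> B"
    using continuous_bounded_on_compact_type[OF assms(1,2)] by metis
  moreover have "g \<in> borel_measurable \<sigma>"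
    using borel_measurable_continuous_onI[OF assms(2)] prob_measures_sets[OF assms(3)]
      measurable_cong_sets[of \<sigma> borel borel borel] by auto
  ultimately show ?thesis by (intro integrable_const_bound[of _ B]) auto
qed

text \<open>A Dirac mass suffices, types being nonempty. This keeps the suprema over measures from
  being taken over the empty set.\<close>

lemma prob_measures_nonempty: "(prob_measures :: 'y::topological_space measure set) \<noteq> {}"
proof -
  have "return borel (undefined :: 'y) \<in> prob_measures"
    by (auto simp: prob_measures_def intro: prob_space_return)
  thus ?thesis by blast
qed

text \<open>The bounded continuous functions form the vector space type on which Hahn-Banach and
  Riesz are applied; on a compact space it contains every continuous function.\<close>

lemma apply_Bcontfun_compact:
  fixes g :: "'y::metric_space \<Rightarrow> real"
  assumes "compact (UNIV :: 'y set)" "continuous_on UNIV g"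
  shows "apply_bcontfun (Bcontfun g) = g"
  by (rule Bcontfun_inverse)
     (simp add: bcontfun_def assms compact_imp_bounded compact_continuous_image)

lemma apply_bcontfun_sum: "apply_bcontfun (sum f A) y = (\<Sum>a\<in>A. apply_bcontfun (f a) y)"
  for f :: "'a \<Rightarrow> ('y::topological_space \<Rightarrow>\<^sub>C real)"
  by (induction A rule: infinite_finite_induct) auto

lemma finite_prob_measure:
  fixes w :: "'y::topological_space \<Rightarrow> real"
  assumes "finite A" "\<And>a. a \<in> A \<Longrightarrow> 0 \<le> w a" "sum w A = 1"
  obtains \<sigma> where "\<sigma> \<in> prob_measures"
    "\<And>h::'y \<Rightarrow> real. h \<in> borel_measurable borel \<Longrightarrow> (\<integral>y. h y \<partial>\<sigma>) = (\<Sum>a\<in>A. w a * h a)"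
proof -
  let ?M = "point_measure A (\<lambda>a. ennreal (w a))"
  have "prob_space ?M"
  proof (rule prob_spaceI)
    have "emeasure ?M (space ?M) = (\<Sum>a\<in>A. ennreal (w a))"
      using assms(1) by (simp add: emeasure_point_measure_finite space_point_measure)
    also have "\<dots> = ennreal (sum w A)" using assms(2) by (rule sum_ennreal)
    finally show "emeasure ?M (space ?M) = 1" using assms(3) by simp
  qed
  \<comment> \<open>The identity carries the measure from the discrete sigma-algebra on
    \<open>A\<close> to the Borel sets.\<close>
  have id: "(\<lambda>y. y) \<in> measurable ?M borel" by simp
  show ?thesis
  proof (rule that)
    show "distr ?M borel (\<lambda>y. y) \<in> prob_measures"
      using prob_space.prob_space_distr[OF \<open>prob_space ?M\<close> id] by (simp add: prob_measures_def)
    show "(\<integral>y. h y \<partial>distr ?M borel (\<lambda>y. y)) = (\<Sum>a\<in>A. w a * h a)"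
      if "h \<in> borel_measurable borel" for h :: "'y \<Rightarrow> real"
      using assms(1,2) by (simp add: integral_distr[OF id that] lebesgue_integral_point_measure_finite)
  qed
qed

text \<open>For a partition of unity \<open>\<phi> a\<close> subordinate to balls of radius
  \<open>d\<close> around a finite net, \<open>\<sigma>\<close> gives mass
  \<open>L (\<phi> a)\<close> to the point \<open>a\<close>. It is chosen before \<open>h\<close>,
  so one measure serves all functions at the scale \<open>d\<close>.\<close>

lemma positive_functional_finite_approximation:
  fixes L :: "('y::metric_space \<Rightarrow>\<^sub>C real) \<Rightarrow> real"
  assumes Y: "compact (UNIV :: 'y set)" and L: "linear L"
    and pos: "\<And>h. (\<And>y. 0 \<le> apply_bcontfun h y) \<Longrightarrow> 0 \<le> L h"
    and one: "L (const_bcontfun 1) = 1"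
    and "0 < d"
  obtains \<sigma> where "\<sigma> \<in> prob_measures"
    "\<And>h e. (\<And>y y'. dist y y' < d \<Longrightarrow> \<bar>apply_bcontfun h y - apply_bcontfun h y'\<bar> \<le> e) \<Longrightarrow>
       \<bar>L h - (\<integral>y. apply_bcontfun h y \<partial>\<sigma>)\<bar> \<le> e"
proof -
  obtain A :: "'y set" where A: "finite A" "UNIV \<subseteq> (\<Union>a\<in>A. ball a d)"
    using Y[unfolded compact_eq_totally_bounded] \<open>0 < d\<close> by blast
  \<comment> \<open>Tent functions vanishing outside the balls of the net; their sum is positive
    because these balls cover the space.\<close>
  define \<psi> where "\<psi> a y = max 0 (d - dist y a)" for a y :: 'y
  define \<Psi> where "\<Psi> y = (\<Sum>a\<in>A. \<psi> a y)" for y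
  have \<psi>0: "0 \<le> \<psi> a y" for a y by (simp add: \<psi>_def)
  have \<Psi>: "0 < \<Psi> y" for y
  proof -
    obtain a where "a \<in> A" "y \<in> ball a d" using A(2) by blast
    hence "dist a y < d" by simp
    hence "0 < \<psi> a y" by (simp add: \<psi>_def dist_commute)
    also have "\<psi> a y \<le> \<Psi> y"
      unfolding \<Psi>_def using A(1) \<open>a \<in> A\<close> \<psi>0 by (intro member_le_sum) auto
    finally show ?thesis .
  qed
  define \<phi> where "\<phi> a = Bcontfun (\<lambda>y. \<psi> a y / \<Psi> y)" for a
  have \<phi>: "apply_bcontfun (\<phi> a) = (\<lambda>y. \<psi> a y / \<Psi> y)" for a
    unfolding \<phi>_def
  proof (rule apply_Bcontfun_compact[OF Y])
    show "continuous_on UNIV (\<lambda>y. \<psi> a y / \<Psi> y)"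
      using \<Psi> unfolding \<Psi>_def \<psi>_def by (intro continuous_intros) (auto simp: less_imp_neq[symmetric])
  qed
  have \<phi>0: "0 \<le> apply_bcontfun (\<phi> a) y" for a y using \<psi>0 \<Psi>[of y] by (simp add: \<phi>)
  have \<phi>1: "(\<Sum>a\<in>A. apply_bcontfun (\<phi> a) y) = 1" for y
    using \<Psi>[of y] by (simp add: \<phi> \<Psi>_def sum_divide_distrib[symmetric])
  have "sum \<phi> A = const_bcontfun 1"
    by (rule bcontfun_eqI) (simp add: apply_bcontfun_sum \<phi>1)
  hence sum1: "(\<Sum>a\<in>A. L (\<phi> a)) = 1" using linear_sum[OF L, of \<phi> A] one by simp
  obtain \<sigma> where \<sigma>: "\<sigma> \<in> prob_measures"
    "\<And>h::'y \<Rightarrow> real. h \<in> borel_measurable borel \<Longrightarrow> (\<integral>y. h y \<partial>\<sigma>) = (\<Sum>a\<in>A. L (\<phi> a) * h a)"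
    using finite_prob_measure[of A "\<lambda>a. L (\<phi> a)", OF A(1) pos[OF \<phi>0] sum1] by blast
  have le: "L h \<le> L k" if "\<And>y. apply_bcontfun h y \<le> apply_bcontfun k y" for h k
    using pos[of "k - h"] that by (simp add: linear_diff[OF L])
  have "\<bar>L h - (\<integral>y. apply_bcontfun h y \<partial>\<sigma>)\<bar> \<le> e"
    if e: "\<And>y y'. dist y y' < d \<Longrightarrow> \<bar>apply_bcontfun h y - apply_bcontfun h y'\<bar> \<le> e" for h and e :: real
  proof -
    \<comment> \<open>The interpolant of \<open>h\<close> at the net: \<open>L k\<close> is the
      integral of \<open>h\<close> against \<open>\<sigma>\<close>, and \<open>k\<close> is
      uniformly within \<open>e\<close> of \<open>h\<close>, since only net points closer than
      \<open>d\<close> contribute.\<close>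
    define k where "k = (\<Sum>a\<in>A. apply_bcontfun h a *\<^sub>R \<phi> a)"
    have "\<bar>apply_bcontfun h y - apply_bcontfun k y\<bar> \<le> e" for y
    proof -
      have "apply_bcontfun h y - apply_bcontfun k y
          = (\<Sum>a\<in>A. (apply_bcontfun h y - apply_bcontfun h a) * apply_bcontfun (\<phi> a) y)"
      proof -
        have "apply_bcontfun h y = (\<Sum>a\<in>A. apply_bcontfun h y * apply_bcontfun (\<phi> a) y)"
          by (metis \<phi>1 sum_distrib_left mult.right_neutral)
        thus ?thesis
          by (simp add: k_def apply_bcontfun_sum left_diff_distrib sum_subtractf)
      qed
      also have "\<bar>\<dots>\<bar> \<le> (\<Sum>a\<in>A. \<bar>(apply_bcontfun h y - apply_bcontfun h a) * apply_bcontfun (\<phi> a) y\<bar>)"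
        by (rule sum_abs)
      also have "\<dots> \<le> (\<Sum>a\<in>A. e * apply_bcontfun (\<phi> a) y)"
      proof (rule sum_mono)
        fix a assume "a \<in> A"
        show "\<bar>(apply_bcontfun h y - apply_bcontfun h a) * apply_bcontfun (\<phi> a) y\<bar>
            \<le> e * apply_bcontfun (\<phi> a) y"
        proof (cases "dist y a < d")
          case True
          with e[OF True] \<phi>0[of a y] show ?thesis by (simp add: abs_mult mult_right_mono)
        next
          case False
          thus ?thesis by (simp add: \<phi> \<psi>_def)
        qed
      qed
      also have "\<dots> = e" by (simp add: sum_distrib_left[symmetric] \<phi>1)
      finally show ?thesis .
    qed
    note close = this
    have L_const: "L (k + const_bcontfun c) = L k + c" for c
    proof -
      have "const_bcontfun c = c *\<^sub>R (const_bcontfun 1 :: 'y \<Rightarrow>\<^sub>C real)"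
        by (rule bcontfun_eqI) simp
      thus ?thesis by (simp add: linear_add[OF L] linear_scale[OF L] one)
    qed
    have "L h \<le> L (k + const_bcontfun e)" "L (k + const_bcontfun (- e)) \<le> L h"
      using close by (intro le; fastforce simp: abs_le_iff algebra_simps)+
    hence "\<bar>L h - L k\<bar> \<le> e" by (simp add: L_const)
    moreover have "L k = (\<Sum>a\<in>A. L (\<phi> a) * apply_bcontfun h a)"
      by (simp add: k_def linear_sum[OF L] linear_scale[OF L] mult.commute)
    moreover have "(\<integral>y. apply_bcontfun h y \<partial>\<sigma>) = (\<Sum>a\<in>A. L (\<phi> a) * apply_bcontfun h a)"
      by (intro \<sigma>(2) borel_measurable_continuous_onI) simp
    ultimately show ?thesis by simp
  qed
  thus ?thesis by (rule that[OF \<sigma>(1)])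
qed

text \<open>By uniform continuity the integrals of each \<open>h\<close> against the approximating
  measures at scale \<open>1 / Suc n\<close> tend to \<open>L h\<close>. A weak limit of a
  subsequence therefore represents \<open>L\<close>.\<close>

theorem Riesz_representation_compact_metric:
  fixes L :: "('y::metric_space \<Rightarrow>\<^sub>C real) \<Rightarrow> real"
  assumes Y: "compact (UNIV :: 'y set)" and L: "linear L"
    and pos: "\<And>h. (\<And>y. 0 \<le> apply_bcontfun h y) \<Longrightarrow> 0 \<le> L h"
    and one: "L (const_bcontfun 1) = 1"
  obtains \<sigma> where "\<sigma> \<in> prob_measures" "\<And>h. L h = (\<integral>y. apply_bcontfun h y \<partial>\<sigma>)"
proof -
  have "\<exists>\<sigma>\<in>prob_measures. \<forall>h e. (\<forall>y y'. dist y y' < 1 / Suc n \<longrightarrow>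
      \<bar>apply_bcontfun h y - apply_bcontfun h y'\<bar> \<le> e) \<longrightarrow> \<bar>L h - (\<integral>y. apply_bcontfun h y \<partial>\<sigma>)\<bar> \<le> e"
    for n :: nat
  proof -
    have "0 < 1 / real (Suc n)" by simp
    from positive_functional_finite_approximation[OF Y L pos one this]
    obtain \<sigma> where "\<sigma> \<in> prob_measures"
      "\<And>h e. (\<And>y y'. dist y y' < 1 / Suc n \<Longrightarrow> \<bar>apply_bcontfun h y - apply_bcontfun h y'\<bar> \<le> e) \<Longrightarrow>
        \<bar>L h - (\<integral>y. apply_bcontfun h y \<partial>\<sigma>)\<bar> \<le> e"
      by blast
    thus ?thesis by blast
  qed
  then obtain \<sigma> :: "nat \<Rightarrow> 'y measure" where \<sigma>: "\<And>n. \<sigma> n \<in> prob_measures"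
    and approx: "\<And>n h e. (\<And>y y'. dist y y' < 1 / Suc n \<Longrightarrow>
      \<bar>apply_bcontfun h y - apply_bcontfun h y'\<bar> \<le> e) \<Longrightarrow> \<bar>L h - (\<integral>y. apply_bcontfun h y \<partial>\<sigma> n)\<bar> \<le> e"
    by metis
  obtain r \<tau> where r: "strict_mono r" and \<tau>: "\<tau> \<in> prob_measures"
    and conv: "\<And>g::'y \<Rightarrow> real. continuous_on UNIV g \<Longrightarrow>
      (\<lambda>n. \<integral>y. g y \<partial>\<sigma> (r n)) \<longlonglongrightarrow> (\<integral>y. g y \<partial>\<tau>)"
    using prob_measures_weak_seq_compact[where \<sigma> = \<sigma>, OF Y \<sigma>] by blast
  have "L h = (\<integral>y. apply_bcontfun h y \<partial>\<tau>)" for h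
  proof -
    have "(\<lambda>n. \<integral>y. apply_bcontfun h y \<partial>\<sigma> n) \<longlonglongrightarrow> L h"
    proof (rule LIMSEQ_I)
      fix e :: real assume "0 < e"
      have "uniformly_continuous_on UNIV (apply_bcontfun h)"
        using Y by (intro compact_uniformly_continuous) auto
      then obtain d where d: "0 < d"
        "\<And>y y'. dist y y' < d \<Longrightarrow> \<bar>apply_bcontfun h y - apply_bcontfun h y'\<bar> < e / 2"
        unfolding uniformly_continuous_on_def using \<open>0 < e\<close>
        by (metis UNIV_I dist_commute dist_real_def half_gt_zero)
      obtain N :: nat where N: "1 / Suc N < d" using nat_approx_posE[OF d(1)] by metis
      have "norm ((\<integral>y. apply_bcontfun h y \<partial>\<sigma> n) - L h) < e" if "n \<ge> N" for n
      proof -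
        have "1 / real (Suc n) \<le> 1 / Suc N" using that by (intro divide_left_mono) auto
        hence "\<bar>L h - (\<integral>y. apply_bcontfun h y \<partial>\<sigma> n)\<bar> \<le> e / 2"
          using d(2) N by (intro approx less_imp_le) auto
        with \<open>0 < e\<close> show ?thesis unfolding real_norm_def by linarith
      qed
      thus "\<exists>N. \<forall>n\<ge>N. norm ((\<integral>y. apply_bcontfun h y \<partial>\<sigma> n) - L h) < e" by blast
    qed
    hence "(\<lambda>n. \<integral>y. apply_bcontfun h y \<partial>\<sigma> (r n)) \<longlonglongrightarrow> L h"
      using LIMSEQ_subseq_LIMSEQ[OF _ r, of "\<lambda>n. \<integral>y. apply_bcontfun h y \<partial>\<sigma> n"] by (simp add: o_def)
    thus ?thesis using conv[of "apply_bcontfun h"] by (auto intro: LIMSEQ_unique)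
  qed
  with \<tau> that show ?thesis by blast
qed

subsection \<open>Kantorovich operators\<close>

lemma backward_kantorovich_USC: "backward_kantorovich S \<Longrightarrow> continuous_on UNIV g \<Longrightarrow> S g \<in> USC"
  by (simp add: backward_kantorovich_def)

lemma backward_kantorovich_mono:
  "\<lbrakk>backward_kantorovich S; continuous_on UNIV g; continuous_on UNIV h; \<And>y. g y \<le> h y\<rbrakk> \<Longrightarrow> S g x \<le> S h x"
  unfolding backward_kantorovich_def by (auto simp: le_fun_def)

lemma backward_kantorovich_translate:
  "backward_kantorovich S \<Longrightarrow> continuous_on UNIV g \<Longrightarrow> S (\<lambda>y. g y + c) x = S g x + ereal c"
  by (simp add: backward_kantorovich_def)

lemma backward_kantorovich_convex:
  "\<lbrakk>backward_kantorovich S; continuous_on UNIV g; continuous_on UNIV h; 0 \<le> l; l \<le> 1\<rbrakk> \<Longrightarrow>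
     S (\<lambda>y. l * g y + (1 - l) * h y) x \<le> ereal l * S g x + ereal (1 - l) * S h x"
  by (simp add: backward_kantorovich_def)

lemma backward_kantorovich_finite:
  fixes S :: "('y::metric_space \<Rightarrow> real) \<Rightarrow> ('x::topological_space \<Rightarrow> ereal)"
  assumes Y: "compact (UNIV :: 'y set)" and S: "backward_kantorovich S"
    and g: "continuous_on UNIV g" and h: "continuous_on UNIV h" and fin: "S g x \<noteq> -\<infinity>"
  shows "\<bar>S h x\<bar> \<noteq> \<infinity>"
proof -
  obtain B C where "\<And>y. \<bar>g y\<bar> \<le> B" "\<And>y. \<bar>h y\<bar> \<le> C"
    using continuous_bounded_on_compact_type[OF Y g] continuous_bounded_on_compact_type[OF Y h] by metis
  hence "g y \<le> h y + (B + C)" for y by (smt (verit))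
  hence "S g x \<le> S (\<lambda>y. h y + (B + C)) x"
    using g h by (intro backward_kantorovich_mono[OF S] continuous_intros) auto
  also have "\<dots> = S h x + ereal (B + C)" by (rule backward_kantorovich_translate[OF S h])
  finally have "S h x \<noteq> -\<infinity>" using fin by (cases "S h x") auto
  moreover obtain M :: real where "S h x \<le> ereal M"
    using backward_kantorovich_USC[OF S h] by (auto simp: USC_def)
  hence "S h x \<noteq> \<infinity>" by auto
  ultimately show ?thesis by auto
qed

text \<open>
  A subgradient of \<open>S(\<cdot>)(x)\<close> is positive and normalised because \<open>S\<close> is monotone and commutes with
  constants, hence it is a probability measure.
\<close>

lemma kantorovich_subgradient:
  fixes S :: "('y::metric_space \<Rightarrow> real) \<Rightarrow> ('x::topological_space \<Rightarrow> ereal)"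
  assumes Y: "compact (UNIV :: 'y set)" and S: "backward_kantorovich S"
    and g: "continuous_on UNIV g" and fin: "S g x \<noteq> -\<infinity>"
  obtains \<sigma> where "\<sigma> \<in> prob_measures"
    "\<And>h. continuous_on UNIV h \<Longrightarrow> S g x + ereal ((\<integral>y. h y \<partial>\<sigma>) - (\<integral>y. g y \<partial>\<sigma>)) \<le> S h x"
proof -
  define p where "p h = real_of_ereal (S (apply_bcontfun h) x)" for h :: "'y \<Rightarrow>\<^sub>C real"
  have p: "S (apply_bcontfun h) x = ereal (p h)" for h
    using backward_kantorovich_finite[OF Y S g _ fin, of "apply_bcontfun h"]
    by (simp add: p_def ereal_real)
  have "convex_on UNIV p"
  proof (rule convex_onI)
    fix t :: real and h k :: "'y \<Rightarrow>\<^sub>C real" assume t: "0 < t" "t < 1"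
    have "apply_bcontfun ((1 - t) *\<^sub>R h + t *\<^sub>R k)
        = (\<lambda>y. t * apply_bcontfun k y + (1 - t) * apply_bcontfun h y)"
      by (auto simp: fun_eq_iff)
    hence "ereal (p ((1 - t) *\<^sub>R h + t *\<^sub>R k))
        \<le> ereal t * ereal (p k) + ereal (1 - t) * ereal (p h)"
      using backward_kantorovich_convex[OF S, of "apply_bcontfun k" "apply_bcontfun h" t x] t
      by (simp add: p[symmetric])
    thus "p ((1 - t) *\<^sub>R h + t *\<^sub>R k) \<le> (1 - t) * p h + t * p k" by simp
  qed simp
  from convex_subgradient_exists[OF this, of "Bcontfun g"]
  obtain L where L: "linear L" and sub: "\<And>h. p (Bcontfun g) + L (h - Bcontfun g) \<le> p h" by blast
  have shift: "L h \<le> p (Bcontfun g + h) - p (Bcontfun g)" for h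
    using sub[of "Bcontfun g + h"] by simp
  have Bg: "apply_bcontfun (Bcontfun g) = g" by (rule apply_Bcontfun_compact[OF Y g])
  have pos: "0 \<le> L h" if "\<And>y. 0 \<le> apply_bcontfun h y" for h
  proof -
    have "S (apply_bcontfun (Bcontfun g + - h)) x \<le> S (apply_bcontfun (Bcontfun g)) x"
      by (rule backward_kantorovich_mono[OF S continuous_on_apply_bcontfun continuous_on_apply_bcontfun])
         (use that in simp)
    hence "p (Bcontfun g + - h) \<le> p (Bcontfun g)" by (simp only: p ereal_less_eq)
    thus ?thesis using shift[of "- h"] by (simp add: linear_neg[OF L])
  qed
  \<comment> \<open>Used for \<open>c = 1\<close> and \<open>c = -1\<close>, which together give
    \<open>L (const_bcontfun 1) = 1\<close>.\<close>
  have const: "L (const_bcontfun c) \<le> c" for c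
  proof -
    have "apply_bcontfun (Bcontfun g + const_bcontfun c) = (\<lambda>y. g y + c)"
      by (auto simp: fun_eq_iff Bg)
    hence "S (apply_bcontfun (Bcontfun g + const_bcontfun c)) x = S g x + ereal c"
      by (simp only: backward_kantorovich_translate[OF S g])
    also have "S g x = ereal (p (Bcontfun g))" using p[of "Bcontfun g"] by (simp only: Bg)
    finally have "p (Bcontfun g + const_bcontfun c) = p (Bcontfun g) + c" unfolding p by simp
    thus ?thesis using shift[of "const_bcontfun c"] by simp
  qed
  have "const_bcontfun (- 1) = - (const_bcontfun 1 :: 'y \<Rightarrow>\<^sub>C real)"
    by (rule bcontfun_eqI) simp
  hence "L (const_bcontfun 1) = 1"
    using const[of 1] const[of "- 1"] by (simp add: linear_neg[OF L])
  from Riesz_representation_compact_metric[OF Y L pos this]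
  obtain \<sigma> where \<sigma>: "\<sigma> \<in> prob_measures" "\<And>h. L h = (\<integral>y. apply_bcontfun h y \<partial>\<sigma>)" by blast
  show ?thesis
  proof (rule that[OF \<sigma>(1)])
    fix h :: "'y \<Rightarrow> real" assume h: "continuous_on UNIV h"
    have Bh: "apply_bcontfun (Bcontfun h) = h" by (rule apply_Bcontfun_compact[OF Y h])
    have "L (Bcontfun h - Bcontfun g) = (\<integral>y. h y \<partial>\<sigma>) - (\<integral>y. g y \<partial>\<sigma>)"
      using \<sigma>(2)[of "Bcontfun h"] \<sigma>(2)[of "Bcontfun g"]
      by (simp only: linear_diff[OF L] Bh Bg)
    thus "S g x + ereal ((\<integral>y. h y \<partial>\<sigma>) - (\<integral>y. g y \<partial>\<sigma>)) \<le> S h x"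
      using sub[of "Bcontfun h"] p[of "Bcontfun g"] p[of "Bcontfun h"] by (simp add: Bh Bg)
  qed
qed

section \<open>The cost of a measure and the dual form of \<open>Tbar\<close>\<close>

text \<open>This is the penalty \<open>c x \<sigma>\<close> in the formula for \<open>Tbar\<close>.
  For a functional capacity on a compact space, passing to real values loses nothing, because
  \<open>T\<close> is finite on indicators of closed sets.\<close>

definition capacity_cost ::
  "(('y::topological_space \<Rightarrow> ereal) \<Rightarrow> ('x \<Rightarrow> ereal)) \<Rightarrow> 'x \<Rightarrow> 'y measure \<Rightarrow> real" where
  "capacity_cost T x \<sigma> =
     (SUP U\<in>{U. open U}. measure \<sigma> U - real_of_ereal (T (indicator (closure U)) x))"

context
  fixes T :: "('y::metric_space \<Rightarrow> ereal) \<Rightarrow> ('x::metric_space \<Rightarrow> ereal)"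
  assumes Y: "compact (UNIV :: 'y set)" and cap: "functional_capacity T"
begin

lemma compact_of_closed: "closed K \<Longrightarrow> compact (K :: 'y set)"
  using compact_Int_closed[OF Y, of K] by simp

lemma capacity_USC: "closed K \<Longrightarrow> T (indicator K) \<in> USC"
  using cap indicator_USC_plus[OF compact_of_closed] by (auto simp: functional_capacity_def)

lemma capacity_decreases:
  "\<lbrakk>\<And>n. f n \<in> USC_plus; h \<in> USC_plus; decreases_to f h\<rbrakk> \<Longrightarrow> decreases_to (\<lambda>n. T (f n)) (T h)"
  using cap by (simp add: functional_capacity_def)

lemma capacity_nonneg: "0 \<le> T (indicator K) x"
  using cap unfolding functional_capacity_def F_plus_def by auto

lemma capacity_bounded:
  assumes "closed K"
  obtains M where "\<And>x. T (indicator K) x \<le> ereal M"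
  using capacity_USC[OF assms] by (auto simp: USC_def)

lemma capacity_real:
  assumes "closed K"
  shows "T (indicator K) x = ereal (real_of_ereal (T (indicator K) x))"
  using capacity_nonneg[of K x] capacity_bounded[OF assms]
  by (metis ereal_infty_less_eq(1) ereal_real' PInfty_neq_ereal(1) abs_ereal_ge0)

lemma capacity_real_nonneg: "0 \<le> real_of_ereal (T (indicator K) x)"
  using capacity_nonneg by (rule real_of_ereal_pos)

lemma capacity_cost_bdd:
  assumes "\<sigma> \<in> prob_measures"
  shows "bdd_above ((\<lambda>U. measure \<sigma> U - real_of_ereal (T (indicator (closure U)) x)) ` {U. open U})"
proof (rule bdd_aboveI2)
  fix U :: "'y set"
  have "measure \<sigma> U \<le> 1"
    using prob_space.prob_le_1[OF prob_measures_prob_space[OF assms]] .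
  thus "measure \<sigma> U - real_of_ereal (T (indicator (closure U)) x) \<le> 1"
    using capacity_real_nonneg[of "closure U" x] by linarith
qed

lemma capacity_cost_ge:
  assumes "\<sigma> \<in> prob_measures" "open U"
  shows "measure \<sigma> U - real_of_ereal (T (indicator (closure U)) x) \<le> capacity_cost T x \<sigma>"
  unfolding capacity_cost_def by (intro cSUP_upper capacity_cost_bdd assms) (use assms in auto)

lemma capacity_cost_le:
  assumes "\<And>U. open U \<Longrightarrow> measure \<sigma> U - real_of_ereal (T (indicator (closure U)) x) \<le> c"
  shows "capacity_cost T x \<sigma> \<le> c"
  unfolding capacity_cost_def using assms by (intro cSUP_least) auto

text \<open>The integral of \<open>g\<close> does not depend on \<open>U\<close>, so it leaves the
  infimum, and the infimum of the negated terms becomes minus the supremum that defines the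
  cost.\<close>

lemma Tbar_inner:
  assumes g: "continuous_on UNIV g" and \<sigma>: "\<sigma> \<in> prob_measures"
  shows "(INF U\<in>{U. open U}. ereal (\<integral>y. g y - indicator U y \<partial>\<sigma>) + T (indicator (closure U)) x)
    = ereal ((\<integral>y. g y \<partial>\<sigma>) - capacity_cost T x \<sigma>)"
proof -
  interpret prob_space \<sigma> using \<sigma> by (rule prob_measures_prob_space)
  have eq: "ereal (\<integral>y. g y - indicator U y \<partial>\<sigma>) + T (indicator (closure U)) x
      = ereal ((\<integral>y. g y \<partial>\<sigma>) - (measure \<sigma> U - real_of_ereal (T (indicator (closure U)) x)))"
    if "open U" for U
  proof -
    have U: "U \<in> sets \<sigma>" using that by (simp add: prob_measures_sets[OF \<sigma>])
    have "(\<integral>y. g y - indicator U y \<partial>\<sigma>) = (\<integral>y. g y \<partial>\<sigma>) - measure \<sigma> U"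
      using U continuous_integrable_prob_measures[OF Y g \<sigma>]
      by (subst Bochner_Integration.integral_diff) (auto simp: emeasure_eq_measure)
    thus ?thesis by (subst capacity_real) auto
  qed
  show ?thesis
  proof (rule INF_eqI)
    fix U :: "'y set" assume "U \<in> {U. open U}"
    thus "ereal ((\<integral>y. g y \<partial>\<sigma>) - capacity_cost T x \<sigma>)
        \<le> ereal (\<integral>y. g y - indicator U y \<partial>\<sigma>) + T (indicator (closure U)) x"
      using capacity_cost_ge[OF \<sigma>, of U x] by (simp add: eq)
  next
    fix z assume z: "\<And>U. U \<in> {U. open U} \<Longrightarrow>
      z \<le> ereal (\<integral>y. g y - indicator U y \<partial>\<sigma>) + T (indicator (closure U)) x"
    show "z \<le> ereal ((\<integral>y. g y \<partial>\<sigma>) - capacity_cost T x \<sigma>)"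
    proof (cases z)
      case (real r)
      have "capacity_cost T x \<sigma> \<le> (\<integral>y. g y \<partial>\<sigma>) - r"
      proof (rule capacity_cost_le)
        fix U :: "'y set" assume "open U"
        thus "measure \<sigma> U - real_of_ereal (T (indicator (closure U)) x) \<le> (\<integral>y. g y \<partial>\<sigma>) - r"
          using z[of U] by (simp add: eq real)
      qed
      thus ?thesis by (simp add: real)
    next
      \<comment> \<open>Excluded by \<open>U = {}\<close>, for which the expression is
        finite.\<close>
      case PInf
      have "z \<le> ereal (\<integral>y. g y - indicator {} y \<partial>\<sigma>) + T (indicator (closure {})) x" by (rule z) simp
      thus ?thesis unfolding eq[OF open_empty] by (simp add: PInf)
    qed simp
  qed
qed

definition Tbar_real :: "('y \<Rightarrow> real) \<Rightarrow> 'x \<Rightarrow> real" where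
  "Tbar_real g x = (SUP \<sigma>\<in>prob_measures. (\<integral>y. g y \<partial>\<sigma>) - capacity_cost T x \<sigma>)"

lemma integral_le_bound:
  fixes g h :: "'y \<Rightarrow> real"
  assumes g: "continuous_on UNIV g" and h: "continuous_on UNIV h" and \<sigma>: "\<sigma> \<in> prob_measures"
    and le: "\<And>y. g y \<le> h y"
  shows "(\<integral>y. g y \<partial>\<sigma>) \<le> (\<integral>y. h y \<partial>\<sigma>)"
  using continuous_integrable_prob_measures[OF Y g \<sigma>] continuous_integrable_prob_measures[OF Y h \<sigma>] le
  by (intro integral_mono)

text \<open>Testing the cost with the empty set shows that it is at least minus the value of
  \<open>T\<close> on the zero indicator. This bounds the objective uniformly in
  \<open>\<sigma>\<close>.\<close>

lemma Tbar_objective_bound: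
  assumes g: "continuous_on UNIV g" and \<sigma>: "\<sigma> \<in> prob_measures" and B: "\<And>y. g y \<le> B"
  shows "(\<integral>y. g y \<partial>\<sigma>) - capacity_cost T x \<sigma> \<le> B + real_of_ereal (T (indicator {}) x)"
proof -
  interpret prob_space \<sigma> using \<sigma> by (rule prob_measures_prob_space)
  have "(\<integral>y. g y \<partial>\<sigma>) \<le> (\<integral>y. B \<partial>\<sigma>)"
    by (rule integral_le_bound[OF g _ \<sigma> B]) simp
  also have "\<dots> = B" by (simp add: prob_space)
  finally show ?thesis using capacity_cost_ge[OF \<sigma>, of "{}" x] by simp
qed

lemma Tbar_objective_bdd:
  assumes "continuous_on UNIV g"
  shows "bdd_above ((\<lambda>\<sigma>. (\<integral>y. g y \<partial>\<sigma>) - capacity_cost T x \<sigma>) ` prob_measures)"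
proof -
  obtain B where "\<And>y. \<bar>g y\<bar> \<le> B" using continuous_bounded_on_compact_type[OF Y assms] by metis
  hence "g y \<le> B" for y by (smt (verit))
  from Tbar_objective_bound[OF assms _ this] show ?thesis by (rule bdd_aboveI2)
qed

lemma Tbar_real_ge:
  assumes "continuous_on UNIV g" "\<sigma> \<in> prob_measures"
  shows "(\<integral>y. g y \<partial>\<sigma>) - capacity_cost T x \<sigma> \<le> Tbar_real g x"
  unfolding Tbar_real_def by (intro cSUP_upper Tbar_objective_bdd assms)

lemma Tbar_real_le:
  assumes "\<And>\<sigma>. \<sigma> \<in> prob_measures \<Longrightarrow> (\<integral>y. g y \<partial>\<sigma>) - capacity_cost T x \<sigma> \<le> c"
  shows "Tbar_real g x \<le> c"
  unfolding Tbar_real_def using assms prob_measures_nonempty by (intro cSUP_least) auto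

lemma Tbar_eq:
  assumes g: "continuous_on UNIV g"
  shows "Tbar T g x = ereal (Tbar_real g x)"
proof -
  have "Tbar T g x = (SUP \<sigma>\<in>prob_measures. ereal ((\<integral>y. g y \<partial>\<sigma>) - capacity_cost T x \<sigma>))"
    unfolding Tbar_def by (intro SUP_cong Tbar_inner[OF g] refl)
  also have "\<dots> = ereal (Tbar_real g x)"
  proof (rule SUP_eqI)
    fix z assume z: "\<And>\<sigma>. \<sigma> \<in> prob_measures \<Longrightarrow> ereal ((\<integral>y. g y \<partial>\<sigma>) - capacity_cost T x \<sigma>) \<le> z"
    show "ereal (Tbar_real g x) \<le> z"
    proof (cases z)
      case (real r)
      thus ?thesis using z by (auto intro: Tbar_real_le)
    next
      case MInf
      thus ?thesis using z prob_measures_nonempty[where 'y = 'y] by auto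
    qed simp
  qed (simp add: Tbar_real_ge[OF g])
  finally show ?thesis .
qed

text \<open>
  The subgradient measure of \<open>S(\<cdot>)(x)\<close> at \<open>g\<close> is a competitor in the supremum defining
  \<open>Tbar T g x\<close>.
\<close>

theorem le_Tbar_if_le_compact:
  assumes S: "backward_kantorovich S" and le: "usc_ext S \<le>\<^sub>K T" and g: "continuous_on UNIV g"
  shows "S g x \<le> Tbar T g x"
proof (cases "S g x = -\<infinity>")
  case False
  obtain \<sigma> where \<sigma>: "\<sigma> \<in> prob_measures" and sub:
    "\<And>h. continuous_on UNIV h \<Longrightarrow> S g x + ereal ((\<integral>y. h y \<partial>\<sigma>) - (\<integral>y. g y \<partial>\<sigma>)) \<le> S h x"
    using kantorovich_subgradient[OF Y S g False] by blast
  interpret prob_space \<sigma> using \<sigma> by (rule prob_measures_prob_space)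
  obtain r where r: "S g x = ereal r"
    using backward_kantorovich_finite[OF Y S g g False] by (cases "S g x") auto
  have "capacity_cost T x \<sigma> \<le> (\<integral>y. g y \<partial>\<sigma>) - r"
  proof (rule capacity_cost_le)
    fix U :: "'y set" assume U: "open U"
    \<comment> \<open>A continuous majorant \<open>h\<close> of the indicator of the closure has
      integral at least \<open>measure \<sigma> U\<close>. The subgradient inequality at
      \<open>h\<close> gives a lower bound not depending on \<open>h\<close>, which survives the
      infimum in \<open>usc_ext\<close>.\<close>
    have "ereal (r + measure \<sigma> U - (\<integral>y. g y \<partial>\<sigma>)) \<le> S h x"
      if h: "continuous_on UNIV h" "\<And>y. indicator (closure U) y \<le> ereal (h y)" for h
    proof -
      have "indicator U y \<le> h y" for y
      proof -
        have "0 \<le> ereal (h y)" by (rule order_trans[OF _ h(2)]) simp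
        moreover have "1 \<le> ereal (h y)" if "y \<in> U"
          using h(2)[of y] subsetD[OF closure_subset that] by simp
        ultimately show ?thesis by (simp add: indicator_def)
      qed
      hence "(\<integral>y. indicator U y \<partial>\<sigma>) \<le> (\<integral>y. h y \<partial>\<sigma>)"
        using U continuous_integrable_prob_measures[OF Y h(1) \<sigma>]
        by (intro integral_mono) (auto simp: prob_measures_sets[OF \<sigma>] emeasure_eq_measure)
      hence "measure \<sigma> U \<le> (\<integral>y. h y \<partial>\<sigma>)"
        using U by (simp add: prob_measures_sets[OF \<sigma>])
      hence "ereal (r + measure \<sigma> U - (\<integral>y. g y \<partial>\<sigma>)) \<le> S g x + ereal ((\<integral>y. h y \<partial>\<sigma>) - (\<integral>y. g y \<partial>\<sigma>))"
        by (simp add: r)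
      also have "\<dots> \<le> S h x" by (rule sub[OF h(1)])
      finally show ?thesis .
    qed
    hence "ereal (r + measure \<sigma> U - (\<integral>y. g y \<partial>\<sigma>)) \<le> usc_ext S (indicator (closure U)) x"
      unfolding usc_ext_def by (intro INF_greatest) auto
    also have "\<dots> \<le> T (indicator (closure U)) x"
      using le compact_of_closed[OF closed_closure] by (auto simp: le_compact_def)
    also have "\<dots> = ereal (real_of_ereal (T (indicator (closure U)) x))"
      by (rule capacity_real) simp
    finally show "measure \<sigma> U - real_of_ereal (T (indicator (closure U)) x) \<le> (\<integral>y. g y \<partial>\<sigma>) - r"
      by simp
  qed
  hence "r \<le> Tbar_real g x" using Tbar_real_ge[OF g \<sigma>, of x] by linarith
  thus ?thesis by (simp add: r Tbar_eq[OF g])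
qed simp

section \<open>Comparison of \<open>Tbar T\<close> with \<open>T\<close> on compact sets\<close>

text \<open>For each \<open>\<sigma>\<close> the integral of \<open>h\<close> is at most
  \<open>measure \<sigma> U\<close>, and the cost contains the term of this very \<open>U\<close>,
  so \<open>measure \<sigma> U\<close> cancels.\<close>

lemma Tbar_le_capacity:
  assumes h: "continuous_on UNIV h" and U: "open U" and le: "\<And>y. h y \<le> indicator U y"
  shows "Tbar T h x \<le> T (indicator (closure U)) x"
proof -
  have "Tbar_real h x \<le> real_of_ereal (T (indicator (closure U)) x)"
  proof (rule Tbar_real_le)
    fix \<sigma> :: "'y measure" assume \<sigma>: "\<sigma> \<in> prob_measures"
    interpret prob_space \<sigma> using \<sigma> by (rule prob_measures_prob_space)
    have "(\<integral>y. h y \<partial>\<sigma>) \<le> (\<integral>y. indicator U y \<partial>\<sigma>)"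
      using U le continuous_integrable_prob_measures[OF Y h \<sigma>]
      by (intro integral_mono) (auto simp: prob_measures_sets[OF \<sigma>] emeasure_eq_measure)
    hence "(\<integral>y. h y \<partial>\<sigma>) \<le> measure \<sigma> U" using U by (simp add: prob_measures_sets[OF \<sigma>])
    thus "(\<integral>y. h y \<partial>\<sigma>) - capacity_cost T x \<sigma> \<le> real_of_ereal (T (indicator (closure U)) x)"
      using capacity_cost_ge[OF \<sigma> U, of x] by linarith
  qed
  thus ?thesis by (subst capacity_real) (auto simp: Tbar_eq[OF h])
qed

text \<open>The closed neighbourhoods \<open>V n\<close> decrease to \<open>K\<close>, and
  \<open>T\<close> is continuous along decreasing sequences in \<open>USC_plus\<close>. Between
  \<open>K\<close> and \<open>U n\<close> there is room for a continuous function, to which the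
  bound by \<open>T\<close> on the closure applies.\<close>

theorem Tbar_le_compact: "usc_ext (Tbar T) \<le>\<^sub>K T"
  unfolding le_compact_def
proof (intro allI impI)
  fix x :: 'x and K :: "'y set" assume K: "compact K"
  have lower: "usc_ext (Tbar T) (indicator K) x \<le> Tbar T h x"
    if "continuous_on UNIV h" "\<And>y. indicator K y \<le> h y" for h
  proof -
    have "indicator K y \<le> ereal (h y)" for y
      using that(2)[of y] by (auto simp: indicator_def split: if_splits)
    thus ?thesis unfolding usc_ext_def using that(1) by (intro INF_lower) auto
  qed
  show "usc_ext (Tbar T) (indicator K) x \<le> T (indicator K) x"
  \<comment> \<open>The empty set is treated apart because \<open>infdist y {}\<close> is 0, which
    would make every \<open>U n\<close> the whole space.\<close>
  proof (cases "K = {}")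
    case True
    have "usc_ext (Tbar T) (indicator K) x \<le> Tbar T (\<lambda>_. 0) x"
      by (rule lower) (auto simp: True)
    also have "\<dots> \<le> T (indicator (closure {})) x" by (rule Tbar_le_capacity) auto
    finally show ?thesis by (simp add: True)
  next
    case False
    define U where "U n = {y. infdist y K < 1 / Suc n}" for n
    have U: "open (U n)" for n
      unfolding U_def by (intro open_Collect_less continuous_intros)
    define V where "V n = closure (U n)" for n
    have V_sub: "V n \<subseteq> {y. infdist y K \<le> 1 / Suc n}" for n
      unfolding V_def U_def by (intro closure_minimal closed_Collect_le continuous_intros) auto
    have KV: "K \<subseteq> V n" for n
      using closure_subset[of "U n"] unfolding V_def by (fastforce simp: U_def)
    have anti: "V n \<subseteq> V m" if "m \<le> n" for m n
    proof -
      have "1 / real (Suc n) \<le> 1 / Suc m" using that by (intro divide_left_mono) auto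
      thus ?thesis unfolding V_def U_def by (intro closure_mono) auto
    qed
    have "decreases_to (\<lambda>n. indicator (V n)) (indicator K :: 'y \<Rightarrow> ereal)"
      unfolding decreases_to_def
    proof (intro conjI allI)
      show "decseq (\<lambda>n. indicator (V n) :: 'y \<Rightarrow> ereal)"
      proof (intro antimonoI le_funI)
        fix m n y assume "m \<le> (n::nat)"
        from subsetD[OF anti[OF this], of y]
        show "(indicator (V n) y :: ereal) \<le> indicator (V m) y" by (auto simp: indicator_def)
      qed
    next
      fix y
      show "(\<lambda>n. indicator (V n) y :: ereal) \<longlonglongrightarrow> indicator K y"
      proof (cases "y \<in> K")
        case True
        thus ?thesis using KV by (auto simp: indicator_def subset_iff)
      next
        case F: False
        hence "0 < infdist y K"
          using infdist_nonneg[of y K] in_closed_iff_infdist_zero[OF compact_imp_closed[OF K] False, of y]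
          by linarith
        then obtain N :: nat where N: "1 / Suc N < infdist y K" using nat_approx_posE by metis
        have "y \<notin> V n" if "N \<le> n" for n using anti[OF that] V_sub[of N] N by auto
        hence "\<forall>\<^sub>F n in sequentially. (indicator (V n) y :: ereal) = indicator K y"
          using F by (auto simp: eventually_sequentially indicator_def)
        thus ?thesis by (rule tendsto_eventually)
      qed
    qed
    moreover have "indicator (V n) \<in> (USC_plus :: ('y \<Rightarrow> ereal) set)" for n
      unfolding V_def by (intro indicator_USC_plus compact_of_closed closed_closure)
    ultimately have "decreases_to (\<lambda>n. T (indicator (V n))) (T (indicator K))"
      using indicator_USC_plus[OF K] by (intro capacity_decreases)
    hence lim: "(\<lambda>n. T (indicator (V n)) x) \<longlonglongrightarrow> T (indicator K) x"
      by (simp add: decreases_to_def)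
    have "usc_ext (Tbar T) (indicator K) x \<le> T (indicator (V n)) x" for n
    proof -
      \<comment> \<open>The slope \<open>Suc n\<close> makes \<open>h\<close> equal to 1 on
        \<open>K\<close> and 0 exactly off \<open>U n\<close>.\<close>
      define h where "h y = max 0 (1 - Suc n * infdist y K)" for y
      have h: "continuous_on UNIV h" unfolding h_def by (intro continuous_intros)
      have hU: "h y \<le> indicator (U n) y" for y
        by (auto simp: h_def U_def indicator_def infdist_nonneg field_simps)
      have "indicator K y \<le> h y" for y by (auto simp: h_def indicator_def)
      hence "usc_ext (Tbar T) (indicator K) x \<le> Tbar T h x" by (rule lower[OF h])
      also have "\<dots> \<le> T (indicator (V n)) x"
        unfolding V_def by (rule Tbar_le_capacity[OF h U hU])
      finally show ?thesis .
    qed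
    thus ?thesis using lim by (intro LIMSEQ_le_const) auto
  qed
qed

section \<open>Monotonicity, translations, convexity and lower semi-continuity in
  \<open>g\<close>\<close>

lemma Tbar_mono:
  assumes g: "continuous_on UNIV g" and h: "continuous_on UNIV h" and le: "\<And>y. g y \<le> h y"
  shows "Tbar T g x \<le> Tbar T h x"
proof -
  have "Tbar_real g x \<le> Tbar_real h x"
  proof (rule Tbar_real_le)
    fix \<sigma> :: "'y measure" assume \<sigma>: "\<sigma> \<in> prob_measures"
    show "(\<integral>y. g y \<partial>\<sigma>) - capacity_cost T x \<sigma> \<le> Tbar_real h x"
      using integral_le_bound[OF g h \<sigma> le] Tbar_real_ge[OF h \<sigma>, of x] by linarith
  qed
  thus ?thesis by (simp add: Tbar_eq g h)
qed

lemma Tbar_translate: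
  assumes g: "continuous_on UNIV g"
  shows "Tbar T (\<lambda>y. g y + c) x = Tbar T g x + ereal c"
proof -
  have gc: "continuous_on UNIV (\<lambda>y. g y + c)" using g by (intro continuous_intros)
  have int: "(\<integral>y. g y + c \<partial>\<sigma>) = (\<integral>y. g y \<partial>\<sigma>) + c" if \<sigma>: "\<sigma> \<in> prob_measures" for \<sigma>
  proof -
    interpret prob_space \<sigma> using \<sigma> by (rule prob_measures_prob_space)
    show ?thesis using continuous_integrable_prob_measures[OF Y g \<sigma>]
      by (subst Bochner_Integration.integral_add) (auto simp: prob_space)
  qed
  have "Tbar_real (\<lambda>y. g y + c) x \<le> Tbar_real g x + c"
  proof (rule Tbar_real_le)
    fix \<sigma> :: "'y measure" assume "\<sigma> \<in> prob_measures"
    thus "(\<integral>y. g y + c \<partial>\<sigma>) - capacity_cost T x \<sigma> \<le> Tbar_real g x + c"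
      using Tbar_real_ge[OF g, of \<sigma> x] by (simp add: int)
  qed
  moreover have "Tbar_real g x \<le> Tbar_real (\<lambda>y. g y + c) x - c"
  proof (rule Tbar_real_le)
    fix \<sigma> :: "'y measure" assume "\<sigma> \<in> prob_measures"
    thus "(\<integral>y. g y \<partial>\<sigma>) - capacity_cost T x \<sigma> \<le> Tbar_real (\<lambda>y. g y + c) x - c"
      using Tbar_real_ge[OF gc, of \<sigma> x] by (simp add: int)
  qed
  ultimately show ?thesis by (simp add: Tbar_eq g gc)
qed

text \<open>For fixed \<open>\<sigma>\<close> the objective is affine in \<open>g\<close>, and a
  supremum of affine functions is convex.\<close>

lemma Tbar_convex:
  assumes g: "continuous_on UNIV g" and h: "continuous_on UNIV h" and l: "0 \<le> l" "l \<le> 1"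
  shows "Tbar T (\<lambda>y. l * g y + (1 - l) * h y) x \<le> ereal l * Tbar T g x + ereal (1 - l) * Tbar T h x"
proof -
  have c: "continuous_on UNIV (\<lambda>y. l * g y + (1 - l) * h y)" using g h by (intro continuous_intros)
  have "Tbar_real (\<lambda>y. l * g y + (1 - l) * h y) x \<le> l * Tbar_real g x + (1 - l) * Tbar_real h x"
  proof (rule Tbar_real_le)
    fix \<sigma> :: "'y measure" assume \<sigma>: "\<sigma> \<in> prob_measures"
    have "(\<integral>y. l * g y + (1 - l) * h y \<partial>\<sigma>) = l * (\<integral>y. g y \<partial>\<sigma>) + (1 - l) * (\<integral>y. h y \<partial>\<sigma>)"
      using continuous_integrable_prob_measures[OF Y g \<sigma>] continuous_integrable_prob_measures[OF Y h \<sigma>]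
      by (subst Bochner_Integration.integral_add) auto
    hence "(\<integral>y. l * g y + (1 - l) * h y \<partial>\<sigma>) - capacity_cost T x \<sigma>
        = l * ((\<integral>y. g y \<partial>\<sigma>) - capacity_cost T x \<sigma>) + (1 - l) * ((\<integral>y. h y \<partial>\<sigma>) - capacity_cost T x \<sigma>)"
      by (simp add: algebra_simps)
    also have "\<dots> \<le> l * Tbar_real g x + (1 - l) * Tbar_real h x"
      using l Tbar_real_ge[OF g \<sigma>, of x] Tbar_real_ge[OF h \<sigma>, of x]
      by (intro add_mono mult_left_mono) auto
    finally show "(\<integral>y. l * g y + (1 - l) * h y \<partial>\<sigma>) - capacity_cost T x \<sigma>
        \<le> l * Tbar_real g x + (1 - l) * Tbar_real h x" .
  qed
  thus ?thesis by (simp add: Tbar_eq g h c)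
qed

text \<open>Monotonicity and translation invariance give a Lipschitz estimate in the uniform norm:
  if \<open>g n\<close> is within \<open>e\<close> of \<open>h\<close>, then
  \<open>Tbar T h x\<close> is at most \<open>Tbar T (g n) x + e\<close>.\<close>

lemma Tbar_lsc:
  fixes g :: "nat \<Rightarrow> 'y \<Rightarrow> real"
  assumes g: "\<And>n. continuous_on UNIV (g n)" and h: "continuous_on UNIV h"
    and lim: "uniform_limit UNIV g h sequentially"
  shows "Tbar T h x \<le> liminf (\<lambda>n. Tbar T (g n) x)"
proof (rule ereal_le_epsilon2)
  fix e :: real assume "0 < e"
  have "\<forall>\<^sub>F n in sequentially. \<forall>y\<in>UNIV. dist (g n y) (h y) < e"
    using uniform_limitD[OF lim \<open>0 < e\<close>] .
  hence "\<forall>\<^sub>F n in sequentially. Tbar T h x - ereal e \<le> Tbar T (g n) x"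
  proof eventually_elim
    case (elim n)
    have "h y \<le> g n y + e" for y
    proof -
      have "\<bar>g n y - h y\<bar> < e" using elim by (auto simp: dist_real_def)
      thus ?thesis by linarith
    qed
    moreover have "continuous_on UNIV (\<lambda>y. g n y + e)" using g by (intro continuous_intros)
    ultimately have "Tbar T h x \<le> Tbar T (\<lambda>y. g n y + e) x" by (intro Tbar_mono h)
    thus ?case by (simp add: Tbar_translate[OF g] Tbar_eq g h)
  qed
  hence "Tbar T h x - ereal e \<le> liminf (\<lambda>n. Tbar T (g n) x)" by (rule Liminf_bounded)
  thus "Tbar T h x \<le> liminf (\<lambda>n. Tbar T (g n) x) + ereal e"
    by (simp add: ereal_minus_le)
qed

section \<open>Upper semi-continuity of \<open>Tbar T g\<close> in \<open>x\<close>\<close>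

text \<open>The portmanteau inequality for open sets. The indicator of \<open>U\<close> is the limit
  of continuous functions \<open>h k\<close> below it; dominated convergence selects one with nearly
  full \<open>\<tau>\<close>-integral, and weak convergence is applied to that one.\<close>

lemma weak_limit_open_lower:
  assumes \<sigma>: "\<And>n. \<sigma> n \<in> prob_measures" and \<tau>: "\<tau> \<in> prob_measures" and U: "open U"
    and lim: "\<And>g::'y \<Rightarrow> real. continuous_on UNIV g \<Longrightarrow>
      (\<lambda>n::nat. \<integral>y. g y \<partial>\<sigma> n) \<longlonglongrightarrow> (\<integral>y. g y \<partial>\<tau>)"
    and e: "0 < e"
  shows "\<forall>\<^sub>F n in sequentially. measure \<tau> U - e < measure (\<sigma> n) U"
\<comment> \<open>The complement must be nonempty, since the distance to the empty set is 0 by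
  convention and every \<open>h k\<close> would vanish.\<close>
proof (cases "U = UNIV")
  case True
  have "measure \<rho> U = 1" if "\<rho> \<in> prob_measures" for \<rho>
    using prob_space.prob_space[OF prob_measures_prob_space[OF that]]
      sets_eq_imp_space_eq[OF prob_measures_sets[OF that]] True by simp
  with \<sigma> \<tau> e show ?thesis by simp
next
  case False
  interpret \<tau>: prob_space \<tau> using \<tau> by (rule prob_measures_prob_space)
  define h where "h k y = min 1 (real k * infdist y (- U))" for k y
  have h: "continuous_on UNIV (h k)" for k unfolding h_def by (intro continuous_intros)
  have h_le: "h k y \<le> indicator U y" for k y by (auto simp: h_def indicator_def)
  have h_abs: "\<bar>h k y\<bar> \<le> 1" for k y by (auto simp: h_def infdist_nonneg)
  have h_lim: "(\<lambda>k. h k y) \<longlonglongrightarrow> indicator U y" for y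
  proof (cases "y \<in> U")
    case True
    hence "0 < infdist y (- U)"
      using infdist_nonneg[of y "- U"] in_closed_iff_infdist_zero[of "- U" y] U False
      by (force simp: closed_def)
    then obtain N :: nat where N: "1 / Suc N < infdist y (- U)" using nat_approx_posE by metis
    have "h k y = 1" if "Suc N \<le> k" for k
    proof -
      have "1 \<le> real (Suc N) * infdist y (- U)" using N by (simp add: field_simps)
      also have "\<dots> \<le> real k * infdist y (- U)"
        using that by (intro mult_right_mono infdist_nonneg) auto
      finally show ?thesis by (simp add: h_def)
    qed
    hence "\<forall>\<^sub>F k in sequentially. h k y = indicator U y"
      using True unfolding eventually_sequentially by auto
    thus ?thesis by (rule tendsto_eventually)
  next
    case False
    thus ?thesis by (simp add: h_def)
  qed
  have "(\<lambda>k. \<integral>y. h k y \<partial>\<tau>) \<longlonglongrightarrow> (\<integral>y. indicator U y \<partial>\<tau>)"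
  proof (rule integral_dominated_convergence[where w = "\<lambda>_. 1"])
    show "(\<lambda>y. indicator U y :: real) \<in> borel_measurable \<tau>"
      using U by (intro borel_measurable_indicator) (simp add: prob_measures_sets[OF \<tau>])
    show "h k \<in> borel_measurable \<tau>" for k
      using continuous_integrable_prob_measures[OF Y h \<tau>] by auto
  qed (use h_lim h_abs in auto)
  moreover have "(\<integral>y. indicator U y \<partial>\<tau>) = measure \<tau> U"
    using U by (simp add: prob_measures_sets[OF \<tau>])
  ultimately have "\<forall>\<^sub>F k in sequentially. measure \<tau> U - e < (\<integral>y. h k y \<partial>\<tau>)"
    using e by (intro order_tendstoD(1)) auto
  then obtain k where "measure \<tau> U - e < (\<integral>y. h k y \<partial>\<tau>)"
    by (auto simp: eventually_sequentially)
  with lim[OF h[of k]] have "\<forall>\<^sub>F n in sequentially. measure \<tau> U - e < (\<integral>y. h k y \<partial>\<sigma> n)"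
    by (rule order_tendstoD(1))
  thus ?thesis
  proof eventually_elim
    case (elim n)
    interpret prob_space "\<sigma> n" using \<sigma> by (rule prob_measures_prob_space)
    have "(\<integral>y. h k y \<partial>\<sigma> n) \<le> (\<integral>y. indicator U y \<partial>\<sigma> n)"
      using U h_le continuous_integrable_prob_measures[OF Y h \<sigma>]
      by (intro integral_mono) (auto simp: prob_measures_sets[OF \<sigma>] emeasure_eq_measure)
    also have "\<dots> = measure (\<sigma> n) U" using U by (simp add: prob_measures_sets[OF \<sigma>])
    finally show ?case using elim by linarith
  qed
qed

text \<open>Near-maximisers at the points \<open>z n\<close> have a weak limit \<open>\<tau>\<close>
  along a subsequence. For each open \<open>U\<close>, the mass of \<open>U\<close> is lower
  semi-continuous in the measure and \<open>T\<close> on the indicator of its closure is upper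
  semi-continuous in the point, so the cost of \<open>\<tau>\<close> at \<open>x\<close> is small
  enough to give the value \<open>r\<close>.\<close>

lemma Tbar_superlevel_closed:
  assumes g: "continuous_on UNIV g"
  shows "closed {x. r \<le> Tbar_real g x}"
  unfolding closed_sequential_limits
proof (intro allI impI, elim conjE)
  fix z x assume z: "\<forall>n. z n \<in> {x. r \<le> Tbar_real g x}" and lim_z: "z \<longlonglongrightarrow> x"
  have "\<exists>\<sigma>\<in>prob_measures. r - 1 / Suc n < (\<integral>y. g y \<partial>\<sigma>) - capacity_cost T (z n) \<sigma>" for n
  proof -
    have "r - 1 / Suc n < Tbar_real g (z n)" using z by (auto intro: less_le_trans[of _ r])
    thus ?thesis
      unfolding Tbar_real_def
      using less_cSUP_iff[OF prob_measures_nonempty Tbar_objective_bdd[OF g]] by blast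
  qed
  then obtain \<sigma> where \<sigma>: "\<And>n. \<sigma> n \<in> prob_measures"
    and near: "\<And>n. r - 1 / Suc n < (\<integral>y. g y \<partial>\<sigma> n) - capacity_cost T (z n) (\<sigma> n)"
    by metis
  obtain s \<tau> where s: "strict_mono s" and \<tau>: "\<tau> \<in> prob_measures"
    and lim: "\<And>g::'y \<Rightarrow> real. continuous_on UNIV g \<Longrightarrow>
      (\<lambda>n. \<integral>y. g y \<partial>\<sigma> (s n)) \<longlonglongrightarrow> (\<integral>y. g y \<partial>\<tau>)"
    using prob_measures_weak_seq_compact[where \<sigma> = \<sigma>, OF Y \<sigma>] by blast
  have lim_zs: "(\<lambda>n. z (s n)) \<longlonglongrightarrow> x"
    using LIMSEQ_subseq_LIMSEQ[OF lim_z s] by (simp add: o_def)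
  have "capacity_cost T x \<tau> \<le> (\<integral>y. g y \<partial>\<tau>) - r"
  proof (rule capacity_cost_le)
    fix U :: "'y set" assume U: "open U"
    define t where "t x = real_of_ereal (T (indicator (closure U)) x)" for x
    have t: "T (indicator (closure U)) x = ereal (t x)" for x
      unfolding t_def by (rule capacity_real) simp
    have "measure \<tau> U - t x \<le> (\<integral>y. g y \<partial>\<tau>) - r + e" if "0 < e" for e
    proof -
      \<comment> \<open>Four errors of size \<open>d\<close> add up to \<open>e\<close>: the value
        of \<open>T\<close>, the mass of \<open>U\<close>, the integral of \<open>g\<close> and the
        defect of the near-maximiser.\<close>
      define d where "d = e / 4"
      have d: "0 < d" using that by (simp add: d_def)
      have "open {x. T (indicator (closure U)) x < ereal (t x0 + d)}" for x0
        using capacity_USC[OF closed_closure, of U] by (auto simp: USC_def usc_def)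
      hence "open {x'. t x' < t x + d}" by (simp add: t)
      hence 1: "\<forall>\<^sub>F n in sequentially. t (z (s n)) < t x + d"
        using topological_tendstoD[OF lim_zs, of "{x'. t x' < t x + d}"] d by simp
      have 2: "\<forall>\<^sub>F n in sequentially. measure \<tau> U - d < measure (\<sigma> (s n)) U"
        using weak_limit_open_lower[of "\<lambda>n. \<sigma> (s n)", OF \<sigma> \<tau> U lim d] .
      have 3: "\<forall>\<^sub>F n in sequentially. (\<integral>y. g y \<partial>\<sigma> (s n)) < (\<integral>y. g y \<partial>\<tau>) + d"
        using lim[OF g] d by (intro order_tendstoD(2)) auto
      have "(\<lambda>n. 1 / real (Suc (s n))) \<longlonglongrightarrow> 0"
        using LIMSEQ_subseq_LIMSEQ[OF LIMSEQ_inverse_real_of_nat s] by (simp add: o_def inverse_eq_divide)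
      hence 4: "\<forall>\<^sub>F n in sequentially. 1 / real (Suc (s n)) < d"
        using d by (rule order_tendstoD(2))
      have "\<forall>\<^sub>F n in sequentially. measure \<tau> U - t x \<le> (\<integral>y. g y \<partial>\<tau>) - r + e"
        using 1 2 3 4
      proof eventually_elim
        case (elim n)
        have "measure (\<sigma> (s n)) U - t (z (s n)) \<le> capacity_cost T (z (s n)) (\<sigma> (s n))"
          unfolding t_def by (rule capacity_cost_ge[OF \<sigma> U])
        with elim near[of "s n"] show ?case unfolding d_def by linarith
      qed
      thus ?thesis by simp
    qed
    hence "measure \<tau> U - t x \<le> (\<integral>y. g y \<partial>\<tau>) - r" by (rule field_le_epsilon)
    thus "measure \<tau> U - real_of_ereal (T (indicator (closure U)) x) \<le> (\<integral>y. g y \<partial>\<tau>) - r"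
      by (simp add: t_def)
  qed
  thus "x \<in> {x. r \<le> Tbar_real g x}" using Tbar_real_ge[OF g \<tau>, of x] by simp
qed

text \<open>The bound uniform in \<open>x\<close> comes from \<open>T\<close> on the empty set,
  which is bounded above; properness holds because all values are real.\<close>

lemma Tbar_USC:
  assumes g: "continuous_on UNIV g"
  shows "Tbar T g \<in> USC"
proof -
  have "open {x. Tbar T g x < a}" for a
  proof (cases a)
    case (real r)
    have "{x. Tbar T g x < a} = - {x. r \<le> Tbar_real g x}" by (auto simp: real Tbar_eq[OF g])
    thus ?thesis using Tbar_superlevel_closed[OF g, of r] by (simp add: open_Compl)
  qed (simp_all add: Tbar_eq[OF g])
  moreover obtain B where "\<And>y. \<bar>g y\<bar> \<le> B" using continuous_bounded_on_compact_type[OF Y g] by metis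
  hence B: "g y \<le> B" for y by (smt (verit))
  obtain M where M: "\<And>x. T (indicator {}) x \<le> ereal M" using capacity_bounded[OF closed_empty] by blast
  have "Tbar T g x \<le> ereal (B + M)" for x
  proof -
    have "Tbar_real g x \<le> B + real_of_ereal (T (indicator {}) x)"
      by (rule Tbar_real_le) (rule Tbar_objective_bound[OF g _ B])
    moreover have "ereal (real_of_ereal (T (indicator {}) x)) \<le> ereal M"
      using M[of x] capacity_real[OF closed_empty, of x] by simp
    ultimately show ?thesis by (simp add: Tbar_eq[OF g])
  qed
  ultimately show ?thesis by (auto simp: USC_def usc_def Tbar_eq[OF g])
qed

theorem Tbar_backward_kantorovich: "backward_kantorovich (Tbar T)"
  unfolding backward_kantorovich_def le_fun_def
  by (intro conjI allI impI; (elim conjE)?)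
     (auto intro: Tbar_USC Tbar_mono Tbar_translate Tbar_convex Tbar_lsc)

end

section \<open>Saturation, maximality and minimality\<close>

lemma usc_ext_mono:
  assumes "\<And>g x. continuous_on UNIV g \<Longrightarrow> S g x \<le> R g x"
  shows "usc_ext S f x \<le> usc_ext R f x"
  unfolding usc_ext_def using assms by (intro INF_mono) auto

lemma le_usc_imp_le_compact: "S \<le>\<^sub>U T \<Longrightarrow> S \<le>\<^sub>K T"
  for S T :: "('y::t2_space \<Rightarrow> ereal) \<Rightarrow> ('x \<Rightarrow> ereal)"
  unfolding le_usc_def le_compact_def using indicator_USC_plus by blast

lemma le_compact_trans: "S \<le>\<^sub>K T \<Longrightarrow> T \<le>\<^sub>K R \<Longrightarrow> S \<le>\<^sub>K R"
  unfolding le_compact_def by (meson order_trans)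

theorem theorem6p12:
  fixes T :: "('y::metric_space \<Rightarrow> ereal) \<Rightarrow> ('x::metric_space \<Rightarrow> ereal)"
  assumes "compact (UNIV :: 'x set)" and "compact (UNIV :: 'y set)"
    and "functional_capacity T" and "compactly_standard T"
  shows
    "(backward_kantorovich (Tbar T) \<and> K_saturated (usc_ext (Tbar T)) \<and> usc_ext (Tbar T) \<le>\<^sub>K T) \<and>
     (kantorovich_capacity T \<longrightarrow>
        T \<le>\<^sub>U usc_ext (Tbar T) \<and>
        (\<forall>g x. continuous_on UNIV g \<longrightarrow>
           Tbar T g x = (SUP S\<in>{S. backward_kantorovich S \<and> choquet_le (usc_ext S) T}. S g x))) \<and>
     (K_saturated T \<longrightarrow> usc_ext (Tbar T) \<le>\<^sub>U T) \<and>
     (K_saturated T \<and> kantorovich_capacity T \<longrightarrow> (\<forall>f\<in>USC_plus. T f = usc_ext (Tbar T) f)) \<and>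
     (\<forall>R. backward_kantorovich R \<and> K_saturated (usc_ext R) \<and> T \<le>\<^sub>U usc_ext R \<longrightarrow>
        usc_ext (Tbar T) \<le>\<^sub>U usc_ext R)"
proof -
  note Y = assms(2,3)
  have bk: "backward_kantorovich (Tbar T)" by (rule Tbar_backward_kantorovich[OF Y])
  have leK: "usc_ext (Tbar T) \<le>\<^sub>K T" by (rule Tbar_le_compact[OF Y])
  \<comment> \<open>Domination on continuous functions passes to the extensions, which are infima
    over the same continuous majorants.\<close>
  have dom: "usc_ext S \<le>\<^sub>U usc_ext (Tbar T)" if "backward_kantorovich S" "usc_ext S \<le>\<^sub>K T" for S
    using le_Tbar_if_le_compact[OF Y that] by (auto simp: le_usc_def intro: usc_ext_mono)
  \<comment> \<open>An operator below \<open>Tbar T\<close> on compact sets is also below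
    \<open>T\<close> there, so \<open>dom\<close> applies to it.\<close>
  have sat: "K_saturated (usc_ext (Tbar T))"
    unfolding K_saturated_def
    using dom le_compact_trans[OF _ leK] le_usc_imp_le_compact by blast
  \<comment> \<open>The operator \<open>S\<close> representing \<open>T\<close> agrees with it on
    indicators of compact sets, hence \<open>dom\<close> applies to \<open>S\<close>.\<close>
  have kant: "T \<le>\<^sub>U usc_ext (Tbar T)" if T: "kantorovich_capacity T"
  proof -
    obtain S where S: "backward_kantorovich S" "\<And>f. f \<in> USC_plus \<Longrightarrow> T f = usc_ext S f"
      using T by (auto simp: kantorovich_capacity_def)
    hence "usc_ext S \<le>\<^sub>K T" by (simp add: le_compact_def indicator_USC_plus)
    from dom[OF S(1) this] show ?thesis by (simp add: le_usc_def S(2))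
  qed
  \<comment> \<open>The supremum is attained: \<open>Tbar T\<close> is itself an admissible
    operator.\<close>
  have sup: "Tbar T g x = (SUP S\<in>{S. backward_kantorovich S \<and> choquet_le (usc_ext S) T}. S g x)"
    if "continuous_on UNIV g" for g x
  proof (rule antisym)
    show "Tbar T g x \<le> (SUP S\<in>{S. backward_kantorovich S \<and> choquet_le (usc_ext S) T}. S g x)"
      using bk leK by (intro SUP_upper) (simp add: choquet_le_def)
    show "(SUP S\<in>{S. backward_kantorovich S \<and> choquet_le (usc_ext S) T}. S g x) \<le> Tbar T g x"
      using le_Tbar_if_le_compact[OF Y _ _ that] by (intro SUP_least) (simp add: choquet_le_def)
  qed
  have satT: "usc_ext (Tbar T) \<le>\<^sub>U T" if "K_saturated T"
    using that bk leK unfolding K_saturated_def by blast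
  have eq: "T f = usc_ext (Tbar T) f" if "K_saturated T" "kantorovich_capacity T" "f \<in> USC_plus" for f
    using satT[OF that(1)] kant[OF that(2)] that(3) unfolding le_usc_def
    by (intro ext antisym) blast+
  \<comment> \<open>Saturation of \<open>R\<close> is applied to \<open>Tbar T\<close>, which lies
    below \<open>T\<close>, and hence below the extension of \<open>R\<close>, on compact
    sets.\<close>
  have minimal: "usc_ext (Tbar T) \<le>\<^sub>U usc_ext R" if "K_saturated (usc_ext R)" "T \<le>\<^sub>U usc_ext R" for R
    using that bk le_compact_trans[OF leK le_usc_imp_le_compact[OF that(2)]]
    unfolding K_saturated_def by blast
  show ?thesis using bk sat leK kant sup satT eq minimal by blast
qed

end
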